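(* Let $U$ be the unitary operator on $\mathcal H\otimes\mathcal H$ defined by $$U\xi(x,y,r,x',y',r')=(e^{-\lambda r'})^n\,\bar e\bigl[\eta_\lambda(r')\beta(e^{-\lambda r'}x,\,y'-e^{-\lambda r'}y)\bigr]\,\xi\bigl(e^{-\lambda r'}x,e^{-\lambda r'}y,r+r',x'-e^{-\lambda r'}x,y'-e^{-\lambda r'}y,r'\bigr).$$ Then $U$ is multiplicative, i.e. it satisfies the pentagon equation $$U_{12}U_{13}U_{23}=U_{23}U_{12}\quad\text{on }\mathcal H\otimes\mathcal H\otimes\mathcal H.$$
   Context: Fix an integer $n\ge1$ and a nonzero real $\lambda$. $\beta$ is the usual inner product on $\mathbb R^n$, $\bar e(t)=e^{-2\pi it}$, $\eta_\lambda(r)=\frac{e^{2\lambda r}-1}{2\lambda}$. $\mathcal H=L^2(\mathbb R^n\times\mathbb R^n\times\mathbb R)$ (Lebesgue measure), with variables $(x,y,r)$; $\mathcal H\otimes\mathcal H$ is identified with the $L^2$-space in the variables $(x,y,r,x',y',r')$. $U_{ij}$ denotes $U$ acting on the $i$-th and $j$-th tensor factors of $\mathcal H\otimes\mathcal H\otimes\mathcal H$. *)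

theory Defs
  imports "HOL-Analysis.Analysis"
begin

section \<open>The Hilbert space of square-integrable functions\<close>

text \<open>
  Elements of \<open>'a l2\<close> are classes of Borel measurable, square-integrable complex functions on the
  Euclidean space \<open>'a\<close> modulo equality almost everywhere.  Every Lebesgue measurable function
  agrees almost everywhere with a Borel measurable one, so this is \<open>L\<^sup>2\<close> for Lebesgue measure.
\<close>

definition square_integrable :: "('a::euclidean_space \<Rightarrow> complex) \<Rightarrow> bool" where
  "square_integrable f \<longleftrightarrow>
     f \<in> borel_measurable borel \<and> integrable lborel (\<lambda>x. (cmod (f x))\<^sup>2)"

definition l2_rel :: "('a::euclidean_space \<Rightarrow> complex) \<Rightarrow> ('a \<Rightarrow> complex) \<Rightarrow> bool" where
  "l2_rel f g \<longleftrightarrow> square_integrable f \<and> square_integrable g \<and> (AE x in lborel. f x = g x)"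

lemma borel_measurable_cnj [measurable (raw)]:
  "f \<in> borel_measurable M \<Longrightarrow> (\<lambda>x. cnj (f x)) \<in> borel_measurable M"
  by (rule borel_measurable_continuous_on[of cnj]) (intro continuous_intros)

lemma borel_measurable_fst_snd [measurable (raw)]:
  fixes f :: "'c \<Rightarrow> 'a::euclidean_space \<times> 'b::euclidean_space"
  assumes "f \<in> borel_measurable M"
  shows "(\<lambda>x. fst (f x)) \<in> borel_measurable M" "(\<lambda>x. snd (f x)) \<in> borel_measurable M"
  using assms by (auto intro!: borel_measurable_continuous_on[of fst] borel_measurable_continuous_on[of snd]
    continuous_intros)

lemma square_integrable_zero [simp]: "square_integrable (\<lambda>_. 0)"
  by (simp add: square_integrable_def)

lemma l2_rel_part_equivp: "part_equivp (l2_rel :: ('a::euclidean_space \<Rightarrow> complex) \<Rightarrow> _)"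
proof (rule part_equivpI)
  show "\<exists>f. l2_rel f (f :: 'a \<Rightarrow> complex)"
    by (rule exI[of _ "\<lambda>_. 0"]) (simp add: l2_rel_def)
  show "symp (l2_rel :: ('a \<Rightarrow> complex) \<Rightarrow> _)"
    by (rule sympI) (auto simp: l2_rel_def eq_commute)
  show "transp (l2_rel :: ('a \<Rightarrow> complex) \<Rightarrow> _)"
  proof (rule transpI)
    fix f g h :: "'a \<Rightarrow> complex"
    assume "l2_rel f g" "l2_rel g h"
    then have "AE x in lborel. f x = g x" "AE x in lborel. g x = h x"
      by (auto simp: l2_rel_def)
    then have "AE x in lborel. f x = h x"
      by eventually_elim simp
    with \<open>l2_rel f g\<close> \<open>l2_rel g h\<close> show "l2_rel f h"
      by (simp add: l2_rel_def)
  qed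
qed

quotient_type (overloaded) 'a l2 = "'a::euclidean_space \<Rightarrow> complex" / partial: l2_rel
  by (rule l2_rel_part_equivp)

lemma l2_relD:
  assumes "l2_rel f g"
  shows "square_integrable f" "square_integrable g" "AE x in lborel. f x = g x"
    "f \<in> borel_measurable borel" "g \<in> borel_measurable borel"
  using assms by (auto simp: l2_rel_def square_integrable_def)

lemma square_integrable_add:
  assumes "square_integrable f" "square_integrable g"
  shows "square_integrable (\<lambda>x. f x + g x)"
proof -
  have [measurable]: "f \<in> borel_measurable borel" "g \<in> borel_measurable borel"
    using assms by (auto simp: square_integrable_def)
  have i: "integrable lborel (\<lambda>x. 2 * (cmod (f x))\<^sup>2 + 2 * (cmod (g x))\<^sup>2)"
    using assms by (auto simp: square_integrable_def)
  have b: "(cmod (f x + g x))\<^sup>2 \<le> 2 * (cmod (f x))\<^sup>2 + 2 * (cmod (g x))\<^sup>2" for x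
  proof -
    have "(cmod (f x + g x))\<^sup>2 \<le> (cmod (f x) + cmod (g x))\<^sup>2"
      by (simp add: power_mono norm_triangle_ineq)
    also have "\<dots> \<le> 2 * (cmod (f x))\<^sup>2 + 2 * (cmod (g x))\<^sup>2"
      using sum_squares_bound[of "cmod (f x)" "cmod (g x)"] by (simp add: power2_sum)
    finally show ?thesis .
  qed
  show ?thesis
    unfolding square_integrable_def
    by (intro conjI Bochner_Integration.integrable_bound[OF i])
      (auto intro!: AE_I2 order_trans[OF b])
qed

lemma square_integrable_cmult:
  assumes "square_integrable f"
  shows "square_integrable (\<lambda>x. c * f x)"
  using assms by (auto simp: square_integrable_def norm_mult power_mult_distrib)

lemma integrable_mult_cnj:
  assumes "square_integrable f" "square_integrable g"
  shows "integrable lborel (\<lambda>x. f x * cnj (g x))"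
proof -
  have [measurable]: "f \<in> borel_measurable borel" "g \<in> borel_measurable borel"
    using assms by (auto simp: square_integrable_def)
  have i: "integrable lborel (\<lambda>x. (cmod (f x))\<^sup>2 + (cmod (g x))\<^sup>2)"
    using assms by (auto simp: square_integrable_def)
  have b: "cmod (f x * cnj (g x)) \<le> (cmod (f x))\<^sup>2 + (cmod (g x))\<^sup>2" for x
    using sum_squares_bound[of "cmod (f x)" "cmod (g x)"]
      mult_nonneg_nonneg[OF norm_ge_zero[of "f x"] norm_ge_zero[of "g x"]]
    unfolding norm_mult complex_mod_cnj by linarith
  show ?thesis
    by (rule Bochner_Integration.integrable_bound[OF i])
      (auto intro!: AE_I2 order_trans[OF b])
qed

lemma inner_complex_eq_Re: "inner (z::complex) w = Re (z * cnj w)"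
  by (simp add: inner_complex_def)

lemma integrable_inner_l2:
  assumes "square_integrable f" "square_integrable g"
  shows "integrable lborel (\<lambda>x. inner (f x) (g x))"
  unfolding inner_complex_eq_Re by (intro integrable_Re integrable_mult_cnj assms)

lift_definition scaleC :: "complex \<Rightarrow> 'a::euclidean_space l2 \<Rightarrow> 'a l2" (infixr \<open>*\<^sub>C\<close> 75)
  is "\<lambda>c f x. c * f x"
  by (auto simp: l2_rel_def intro: square_integrable_cmult)

lift_definition cinner :: "'a::euclidean_space l2 \<Rightarrow> 'a l2 \<Rightarrow> complex"
  is "\<lambda>f g. \<integral>x. f x * cnj (g x) \<partial>lborel"
proof -
  fix f f' g g' :: "'a \<Rightarrow> complex"
  assume f: "l2_rel f f'" and g: "l2_rel g g'"
  note [measurable] = l2_relD(4,5)[OF f] l2_relD(4,5)[OF g]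
  have "AE x in lborel. f x * cnj (g x) = f' x * cnj (g' x)"
    using l2_relD(3)[OF f] l2_relD(3)[OF g] by eventually_elim simp
  then show "(\<integral>x. f x * cnj (g x) \<partial>lborel) = (\<integral>x. f' x * cnj (g' x) \<partial>lborel)"
    by (intro integral_cong_AE) auto
qed

text \<open>
  The library only has real inner product spaces.  The real inner product below is the real part of
  \<open>cinner\<close>, so it induces the usual norm and topology of \<open>L\<^sup>2\<close>.
\<close>

instantiation l2 :: (euclidean_space) real_inner
begin

lift_definition zero_l2 :: "'a l2" is "\<lambda>_. 0"
  by (simp add: l2_rel_def)

lift_definition plus_l2 :: "'a l2 \<Rightarrow> 'a l2 \<Rightarrow> 'a l2" is "\<lambda>f g x. f x + g x"
proof -
  fix f f' g g' :: "'a \<Rightarrow> complex"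
  assume f: "l2_rel f f'" and g: "l2_rel g g'"
  have "AE x in lborel. f x + g x = f' x + g' x"
    using l2_relD(3)[OF f] l2_relD(3)[OF g] by eventually_elim simp
  then show "l2_rel (\<lambda>x. f x + g x) (\<lambda>x. f' x + g' x)"
    using l2_relD[OF f] l2_relD[OF g] by (simp add: l2_rel_def square_integrable_add)
qed

lift_definition uminus_l2 :: "'a l2 \<Rightarrow> 'a l2" is "\<lambda>f x. - f x"
  by (auto simp: l2_rel_def square_integrable_def)

definition minus_l2 :: "'a l2 \<Rightarrow> 'a l2 \<Rightarrow> 'a l2" where
  "minus_l2 f g = f + - g"

definition scaleR_l2 :: "real \<Rightarrow> 'a l2 \<Rightarrow> 'a l2" where
  "scaleR_l2 c f = complex_of_real c *\<^sub>C f"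

lift_definition inner_l2 :: "'a l2 \<Rightarrow> 'a l2 \<Rightarrow> real"
  is "\<lambda>f g. \<integral>x. inner (f x) (g x) \<partial>lborel"
proof -
  fix f f' g g' :: "'a \<Rightarrow> complex"
  assume f: "l2_rel f f'" and g: "l2_rel g g'"
  note [measurable] = l2_relD(4,5)[OF f] l2_relD(4,5)[OF g]
  have "AE x in lborel. inner (f x) (g x) = inner (f' x) (g' x)"
    using l2_relD(3)[OF f] l2_relD(3)[OF g] by eventually_elim simp
  then show "(\<integral>x. inner (f x) (g x) \<partial>lborel) = (\<integral>x. inner (f' x) (g' x) \<partial>lborel)"
    by (intro integral_cong_AE) auto
qed

definition norm_l2 :: "'a l2 \<Rightarrow> real" where
  "norm_l2 f = sqrt (inner f f)"

definition dist_l2 :: "'a l2 \<Rightarrow> 'a l2 \<Rightarrow> real" where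
  "dist_l2 f g = norm (f - g)"

definition sgn_l2 :: "'a l2 \<Rightarrow> 'a l2" where
  "sgn_l2 f = inverse (norm f) *\<^sub>R f"

definition uniformity_l2 :: "('a l2 \<times> 'a l2) filter" where
  "uniformity_l2 = (INF e\<in>{0<..}. principal {(f, g). dist f g < e})"

definition open_l2 :: "'a l2 set \<Rightarrow> bool" where
  "open_l2 S \<longleftrightarrow> (\<forall>f\<in>S. \<forall>\<^sub>F (f', g) in uniformity. f' = f \<longrightarrow> g \<in> S)"

instance
proof
  fix f g h :: "'a l2" and a b :: real
  show "f + g + h = f + (g + h)"
    by transfer (simp add: l2_rel_def add.assoc square_integrable_add)
  show "f + g = g + f"
    by transfer (simp add: l2_rel_def add.commute square_integrable_add)
  show "0 + f = f"
    by transfer (simp add: l2_rel_def)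
  show "- f + f = 0"
    by transfer (simp add: l2_rel_def)
  show "f - g = f + - g"
    by (simp add: minus_l2_def)
  show "a *\<^sub>R (f + g) = a *\<^sub>R f + a *\<^sub>R g"
    unfolding scaleR_l2_def
    by transfer (simp add: l2_rel_def distrib_left square_integrable_add square_integrable_cmult)
  show "(a + b) *\<^sub>R f = a *\<^sub>R f + b *\<^sub>R f"
    unfolding scaleR_l2_def
    by transfer (simp add: l2_rel_def distrib_right square_integrable_add square_integrable_cmult)
  show "a *\<^sub>R b *\<^sub>R f = (a * b) *\<^sub>R f"
    unfolding scaleR_l2_def
    by transfer (simp add: l2_rel_def mult.assoc square_integrable_cmult)
  show "1 *\<^sub>R f = f"
    unfolding scaleR_l2_def by transfer (simp add: l2_rel_def)
  show "sgn f = inverse (norm f) *\<^sub>R f"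
    by (simp add: sgn_l2_def)
  show "dist f g = norm (f - g)"
    by (simp add: dist_l2_def)
  show "(uniformity :: ('a l2 \<times> 'a l2) filter) = (INF e\<in>{0<..}. principal {(f, g). dist f g < e})"
    by (simp add: uniformity_l2_def)
  show "open S \<longleftrightarrow> (\<forall>f\<in>S. \<forall>\<^sub>F (f', g) in uniformity. f' = f \<longrightarrow> g \<in> S)" for S :: "'a l2 set"
    by (simp add: open_l2_def)
  show "inner f g = inner g f"
    by transfer (simp add: inner_commute)
  show "inner (f + g) h = inner f h + inner g h"
  proof transfer
    fix f g h :: "'a \<Rightarrow> complex"
    assume "l2_rel f f" "l2_rel g g" "l2_rel h h"
    then show "(\<integral>x. inner (f x + g x) (h x) \<partial>lborel) =
        (\<integral>x. inner (f x) (h x) \<partial>lborel) + (\<integral>x. inner (g x) (h x) \<partial>lborel)"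
      by (simp add: inner_add_left l2_rel_def integrable_inner_l2)
  qed
  show "inner (a *\<^sub>R f) g = a * inner f g"
    unfolding scaleR_l2_def
  proof transfer
    fix f g :: "'a \<Rightarrow> complex" and a :: real
    have "inner (complex_of_real a * f x) (g x) = a * inner (f x) (g x)" for x
      by (simp add: inner_complex_def algebra_simps)
    then show "(\<integral>x. inner (complex_of_real a * f x) (g x) \<partial>lborel) =
        a * (\<integral>x. inner (f x) (g x) \<partial>lborel)"
      by simp
  qed
  show "0 \<le> inner f f"
    by transfer simp
  show "inner f f = 0 \<longleftrightarrow> f = 0"
  proof transfer
    fix f :: "'a \<Rightarrow> complex"
    assume f: "l2_rel f f"
    have "(\<integral>x. inner (f x) (f x) \<partial>lborel) = 0 \<longleftrightarrow> (AE x in lborel. inner (f x) (f x) = 0)"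
      using f by (intro integral_nonneg_eq_0_iff_AE) (auto simp: l2_rel_def integrable_inner_l2)
    then show "(\<integral>x. inner (f x) (f x) \<partial>lborel) = 0 \<longleftrightarrow> l2_rel f (\<lambda>_. 0)"
      using f by (simp add: l2_rel_def)
  qed
  show "norm f = sqrt (inner f f)"
    by (simp add: norm_l2_def)
qed

end

definition bounded_clinear :: "('a::euclidean_space l2 \<Rightarrow> 'b::euclidean_space l2) \<Rightarrow> bool" where
  "bounded_clinear T \<longleftrightarrow> bounded_linear T \<and> (\<forall>c f. T (c *\<^sub>C f) = c *\<^sub>C T f)"

definition unitary :: "('a::euclidean_space l2 \<Rightarrow> 'b::euclidean_space l2) \<Rightarrow> bool" where
  "unitary T \<longleftrightarrow> bounded_clinear T \<and> surj T \<and> (\<forall>f g. cinner (T f) (T g) = cinner f g)"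


section \<open>Changes of variables\<close>

lemma nn_integral_lborel_Pair:
  fixes f :: "'a::euclidean_space \<times> 'b::euclidean_space \<Rightarrow> ennreal"
  assumes [measurable]: "f \<in> borel_measurable borel"
  shows "(\<integral>\<^sup>+z. f z \<partial>lborel) = (\<integral>\<^sup>+x. \<integral>\<^sup>+y. f (x, y) \<partial>lborel \<partial>lborel)"
  by (subst lborel.nn_integral_fst) (auto simp: lborel_prod)

lemma nn_integral_lborel_Pair_swap:
  fixes f :: "'a::euclidean_space \<times> 'b::euclidean_space \<Rightarrow> ennreal"
  assumes [measurable]: "f \<in> borel_measurable borel"
  shows "(\<integral>\<^sup>+z. f z \<partial>lborel) = (\<integral>\<^sup>+y. \<integral>\<^sup>+x. f (x, y) \<partial>lborel \<partial>lborel)"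
  by (subst lborel_pair.nn_integral_snd) (auto simp: lborel_prod)

lemma nn_integral_lborel_affine:
  fixes f :: "'a::euclidean_space \<Rightarrow> ennreal"
  assumes [measurable]: "f \<in> borel_measurable borel" and c: "c > 0"
  shows "(\<integral>\<^sup>+x. ennreal (c ^ DIM('a)) * f (t + c *\<^sub>R x) \<partial>lborel) = (\<integral>\<^sup>+x. f x \<partial>lborel)"
  using c
  by (subst (2) lborel_affine[of c t]) (simp_all add: nn_integral_density nn_integral_distr)

lemma l2_rel_change_of_variables:
  fixes T :: "'a::euclidean_space \<Rightarrow> 'b::euclidean_space"
    and u :: "'a \<Rightarrow> complex"
  assumes T [measurable]: "T \<in> borel_measurable borel"
    and u [measurable]: "u \<in> borel_measurable borel"
    and u_nz: "\<And>z. u z \<noteq> 0"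
    and eq: "\<And>h. h \<in> borel_measurable borel \<Longrightarrow>
      (\<integral>\<^sup>+z. ennreal ((cmod (u z))\<^sup>2) * h (T z) \<partial>lborel) = (\<integral>\<^sup>+w. h w \<partial>lborel)"
    and rel: "l2_rel f g"
  shows "l2_rel (\<lambda>z. u z * f (T z)) (\<lambda>z. u z * g (T z))"
proof -
  have sq: "square_integrable (\<lambda>z. u z * k (T z))" if k: "square_integrable k" for k
  proof -
    have [measurable]: "k \<in> borel_measurable borel"
      using k by (simp add: square_integrable_def)
    have "(\<integral>\<^sup>+z. ennreal ((cmod (u z * k (T z)))\<^sup>2) \<partial>lborel)
        = (\<integral>\<^sup>+z. ennreal ((cmod (u z))\<^sup>2) * ennreal ((cmod (k (T z)))\<^sup>2) \<partial>lborel)"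
      by (simp add: norm_mult power_mult_distrib ennreal_mult)
    also have "\<dots> = (\<integral>\<^sup>+w. ennreal ((cmod (k w))\<^sup>2) \<partial>lborel)"
      by (rule eq) measurable
    also have "\<dots> < \<infinity>"
      using k by (simp add: square_integrable_def integrable_iff_bounded)
    finally show ?thesis
      unfolding square_integrable_def integrable_iff_bounded by auto
  qed
  note [measurable] = l2_relD(4,5)[OF rel]
  have "AE w in lborel. f w = g w"
    by (rule l2_relD(3)[OF rel])
  then have "(\<integral>\<^sup>+w. indicator {w. f w \<noteq> g w} w \<partial>lborel) = 0"
    by (subst nn_integral_0_iff_AE) (auto simp: indicator_def)
  moreover have "(\<integral>\<^sup>+z. ennreal ((cmod (u z))\<^sup>2) * indicator {w. f w \<noteq> g w} (T z) \<partial>lborel)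
      = (\<integral>\<^sup>+w. indicator {w. f w \<noteq> g w} w \<partial>lborel)"
    by (rule eq) measurable
  ultimately have "(\<integral>\<^sup>+z. ennreal ((cmod (u z))\<^sup>2) * indicator {w. f w \<noteq> g w} (T z) \<partial>lborel) = 0"
    by (simp only:)
  then have "AE z in lborel. ennreal ((cmod (u z))\<^sup>2) * indicator {w. f w \<noteq> g w} (T z) = 0"
    by (subst (asm) nn_integral_0_iff_AE) measurable
  then have "AE z in lborel. u z * f (T z) = u z * g (T z)"
  proof eventually_elim
    case (elim z)
    moreover have "ennreal ((cmod (u z))\<^sup>2) \<noteq> 0"
      using u_nz[of z] by (simp add: ennreal_eq_0_iff)
    ultimately show ?case
      by (auto simp: indicator_def split: if_splits)
  qed
  then show ?thesis
    using sq l2_relD(1,2)[OF rel] by (simp add: l2_rel_def)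
qed


section \<open>Tensor products and leg numbering\<close>

lemma l2_rel_tensor:
  fixes f f' :: "'a::euclidean_space \<Rightarrow> complex" and g g' :: "'b::euclidean_space \<Rightarrow> complex"
  assumes f: "l2_rel f f'" and g: "l2_rel g g'"
  shows "l2_rel (\<lambda>(p, q). f p * g q) (\<lambda>(p, q). f' p * g' q)"
proof -
  have sq: "square_integrable (\<lambda>(p, q). k p * l q)"
    if k: "square_integrable k" and l: "square_integrable l"
    for k :: "'a \<Rightarrow> complex" and l :: "'b \<Rightarrow> complex"
  proof -
    have [measurable]: "k \<in> borel_measurable borel" "l \<in> borel_measurable borel"
      using k l by (auto simp: square_integrable_def)
    have m: "(\<lambda>(p, q). k p * l q) \<in> borel_measurable borel"
      by (subst borel_prod[symmetric]) measurable
    note [measurable] = m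
    have "(\<integral>\<^sup>+z. ennreal ((cmod (case z of (p, q) \<Rightarrow> k p * l q))\<^sup>2) \<partial>lborel)
        = (\<integral>\<^sup>+p. \<integral>\<^sup>+q. ennreal ((cmod (k p))\<^sup>2) * ennreal ((cmod (l q))\<^sup>2) \<partial>lborel \<partial>lborel)"
      by (subst nn_integral_lborel_Pair) (simp_all add: norm_mult power_mult_distrib ennreal_mult)
    also have "\<dots> = (\<integral>\<^sup>+p. ennreal ((cmod (k p))\<^sup>2) \<partial>lborel) * (\<integral>\<^sup>+q. ennreal ((cmod (l q))\<^sup>2) \<partial>lborel)"
      by (simp add: nn_integral_cmult nn_integral_multc)
    also have "\<dots> < \<infinity>"
      using k l by (simp add: square_integrable_def integrable_iff_bounded ennreal_mult_less_top)
    finally show ?thesis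
      unfolding square_integrable_def integrable_iff_bounded using m by auto
  qed
  note [measurable] = l2_relD(4,5)[OF f] l2_relD(4,5)[OF g]
  have m1: "{z :: 'a \<times> 'b. f (fst z) \<noteq> f' (fst z)} \<in> sets borel"
    "{z :: 'a \<times> 'b. g (snd z) \<noteq> g' (snd z)} \<in> sets borel"
  proof -
    have "{z \<in> space borel. f (fst z) \<noteq> f' (fst z)} \<in> sets (borel :: ('a \<times> 'b) measure)"
      "{z \<in> space borel. g (snd z) \<noteq> g' (snd z)} \<in> sets (borel :: ('a \<times> 'b) measure)"
      by measurable
    then show "{z :: 'a \<times> 'b. f (fst z) \<noteq> f' (fst z)} \<in> sets borel"
      "{z :: 'a \<times> 'b. g (snd z) \<noteq> g' (snd z)} \<in> sets borel"
      by simp_all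
  qed
  have "AE z in (lborel :: ('a \<times> 'b) measure). f (fst z) = f' (fst z)"
  proof -
    have "(\<integral>\<^sup>+z. indicator {z :: 'a \<times> 'b. f (fst z) \<noteq> f' (fst z)} z \<partial>lborel)
        = (\<integral>\<^sup>+q. \<integral>\<^sup>+p. indicator {p. f p \<noteq> f' p} p \<partial>lborel \<partial>(lborel :: 'b measure))"
      using nn_integral_lborel_Pair_swap[OF borel_measurable_indicator[OF m1(1)]]
      by (simp only: indicator_def mem_Collect_eq fst_conv)
    also have "(\<integral>\<^sup>+p. indicator {p. f p \<noteq> f' p} p \<partial>lborel) = 0"
      using l2_relD(3)[OF f] by (subst nn_integral_0_iff_AE) (auto simp: indicator_def)
    finally have "(\<integral>\<^sup>+z. indicator {z :: 'a \<times> 'b. f (fst z) \<noteq> f' (fst z)} z \<partial>lborel) = 0"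
      by (simp only: nn_integral_const mult_zero_left)
    then show ?thesis
      using m1 by (subst (asm) nn_integral_0_iff_AE) (auto simp: indicator_def)
  qed
  moreover have "AE z in (lborel :: ('a \<times> 'b) measure). g (snd z) = g' (snd z)"
  proof -
    have "(\<integral>\<^sup>+z. indicator {z :: 'a \<times> 'b. g (snd z) \<noteq> g' (snd z)} z \<partial>lborel)
        = (\<integral>\<^sup>+p. \<integral>\<^sup>+q. indicator {q. g q \<noteq> g' q} q \<partial>lborel \<partial>(lborel :: 'a measure))"
      using nn_integral_lborel_Pair[OF borel_measurable_indicator[OF m1(2)]]
      by (simp only: indicator_def mem_Collect_eq snd_conv)
    also have "(\<integral>\<^sup>+q. indicator {q. g q \<noteq> g' q} q \<partial>lborel) = 0"
      using l2_relD(3)[OF g] by (subst nn_integral_0_iff_AE) (auto simp: indicator_def)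
    finally have "(\<integral>\<^sup>+z. indicator {z :: 'a \<times> 'b. g (snd z) \<noteq> g' (snd z)} z \<partial>lborel) = 0"
      by (simp only: nn_integral_const mult_zero_left)
    then show ?thesis
      using m1 by (subst (asm) nn_integral_0_iff_AE) (auto simp: indicator_def)
  qed
  ultimately have "AE z in lborel. (case z of (p, q) \<Rightarrow> f p * g q) = (case z of (p, q) \<Rightarrow> f' p * g' q)"
    by eventually_elim (auto simp: case_prod_beta)
  then show ?thesis
    using sq l2_relD(1,2)[OF f] l2_relD(1,2)[OF g] by (simp add: l2_rel_def)
qed

lemma nn_integral_permute_12_3:
  fixes h :: "('a::euclidean_space \<times> 'b::euclidean_space) \<times> 'c::euclidean_space \<Rightarrow> ennreal"
  assumes [measurable]: "h \<in> borel_measurable borel"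
  shows "(\<integral>\<^sup>+z. h ((fst z, fst (snd z)), snd (snd z)) \<partial>lborel) = (\<integral>\<^sup>+w. h w \<partial>lborel)"
  by (simp add: nn_integral_lborel_Pair)

lemma nn_integral_permute_13_2:
  fixes h :: "('a::euclidean_space \<times> 'c::euclidean_space) \<times> 'b::euclidean_space \<Rightarrow> ennreal"
  assumes [measurable]: "h \<in> borel_measurable borel"
  shows "(\<integral>\<^sup>+z. h ((fst z, snd (snd z)), fst (snd z)) \<partial>lborel) = (\<integral>\<^sup>+w. h w \<partial>lborel)"
proof -
  have "(\<integral>\<^sup>+z. h ((fst z, snd (snd z)), fst (snd z)) \<partial>lborel)
      = (\<integral>\<^sup>+x. \<integral>\<^sup>+y. \<integral>\<^sup>+z. h ((x, z), y) \<partial>lborel \<partial>lborel \<partial>lborel)"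
    by (simp add: nn_integral_lborel_Pair)
  also have "\<dots> = (\<integral>\<^sup>+x. \<integral>\<^sup>+z. \<integral>\<^sup>+y. h ((x, z), y) \<partial>lborel \<partial>lborel \<partial>lborel)"
  proof (rule nn_integral_cong)
    fix x :: 'a
    have "(\<lambda>q. h ((x, snd q), fst q)) \<in> borel_measurable borel"
      by measurable
    from nn_integral_lborel_Pair[OF this] nn_integral_lborel_Pair_swap[OF this]
    show "(\<integral>\<^sup>+y. \<integral>\<^sup>+z. h ((x, z), y) \<partial>lborel \<partial>lborel) = (\<integral>\<^sup>+z. \<integral>\<^sup>+y. h ((x, z), y) \<partial>lborel \<partial>lborel)"
      by simp
  qed
  also have "\<dots> = (\<integral>\<^sup>+w. h w \<partial>lborel)"
    by (simp add: nn_integral_lborel_Pair)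
  finally show ?thesis .
qed

lemma nn_integral_permute_23_1:
  fixes h :: "('b::euclidean_space \<times> 'c::euclidean_space) \<times> 'a::euclidean_space \<Rightarrow> ennreal"
  assumes [measurable]: "h \<in> borel_measurable borel"
  shows "(\<integral>\<^sup>+z. h ((fst (snd z), snd (snd z)), fst z) \<partial>lborel) = (\<integral>\<^sup>+w. h w \<partial>lborel)"
proof -
  have "(\<integral>\<^sup>+z. h ((fst (snd z), snd (snd z)), fst z) \<partial>lborel) = (\<integral>\<^sup>+x. \<integral>\<^sup>+y. h (y, x) \<partial>lborel \<partial>lborel)"
    by (simp add: nn_integral_lborel_Pair)
  then show ?thesis
    by (simp add: nn_integral_lborel_Pair_swap)
qed

text \<open>
  The spaces \<open>H \<otimes> H\<close> and \<open>H \<otimes> H \<otimes> H\<close> with \<open>H = L\<^sup>2('a)\<close> are identified with \<open>L\<^sup>2('a \<times> 'a)\<close> and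
  \<open>L\<^sup>2('a \<times> 'a \<times> 'a)\<close>.  For \<open>\<xi> \<in> H \<otimes> H\<close> and \<open>\<zeta> \<in> H\<close>, the following are the three ways to form an
  element of \<open>H \<otimes> H \<otimes> H\<close>: \<open>\<xi>\<close> occupies the indicated pair of legs and \<open>\<zeta>\<close> the remaining one.
\<close>

lift_definition tensor12 :: "('a::euclidean_space \<times> 'a) l2 \<Rightarrow> 'a l2 \<Rightarrow> ('a \<times> 'a \<times> 'a) l2"
  is "\<lambda>\<xi> \<zeta> (p, q, s). \<xi> (p, q) * \<zeta> s"
proof -
  fix f f' :: "'a \<times> 'a \<Rightarrow> complex" and g g' :: "'a \<Rightarrow> complex"
  assume "l2_rel f f'" "l2_rel g g'"
  then have rel: "l2_rel (\<lambda>(w, v). f w * g v) (\<lambda>(w, v). f' w * g' v)"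
    by (rule l2_rel_tensor)
  define T :: "'a \<times> 'a \<times> 'a \<Rightarrow> ('a \<times> 'a) \<times> 'a" where
    "T z = ((fst z, fst (snd z)), snd (snd z))" for z
  have "T \<in> borel_measurable borel"
    unfolding T_def by measurable
  then have "l2_rel (\<lambda>z. 1 * (case T z of (w, v) \<Rightarrow> f w * g v)) (\<lambda>z. 1 * (case T z of (w, v) \<Rightarrow> f' w * g' v))"
    by (rule l2_rel_change_of_variables[OF _ _ _ _ rel])
      (simp_all add: T_def nn_integral_permute_12_3 del: prod.collapse)
  moreover have "(\<lambda>z. 1 * (case T z of (w, v) \<Rightarrow> k w * l v)) = (\<lambda>(p, q, s). k (p, q) * l s)" for k l :: "_ \<Rightarrow> complex"
    by (auto simp: T_def fun_eq_iff)
  ultimately show "l2_rel (\<lambda>(p, q, s). f (p, q) * g s) (\<lambda>(p, q, s). f' (p, q) * g' s)"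
    by (simp only:)
qed

lift_definition tensor13 :: "('a::euclidean_space \<times> 'a) l2 \<Rightarrow> 'a l2 \<Rightarrow> ('a \<times> 'a \<times> 'a) l2"
  is "\<lambda>\<xi> \<zeta> (p, q, s). \<xi> (p, s) * \<zeta> q"
proof -
  fix f f' :: "'a \<times> 'a \<Rightarrow> complex" and g g' :: "'a \<Rightarrow> complex"
  assume "l2_rel f f'" "l2_rel g g'"
  then have rel: "l2_rel (\<lambda>(w, v). f w * g v) (\<lambda>(w, v). f' w * g' v)"
    by (rule l2_rel_tensor)
  define T :: "'a \<times> 'a \<times> 'a \<Rightarrow> ('a \<times> 'a) \<times> 'a" where
    "T z = ((fst z, snd (snd z)), fst (snd z))" for z
  have "T \<in> borel_measurable borel"
    unfolding T_def by measurable
  then have "l2_rel (\<lambda>z. 1 * (case T z of (w, v) \<Rightarrow> f w * g v)) (\<lambda>z. 1 * (case T z of (w, v) \<Rightarrow> f' w * g' v))"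
    by (rule l2_rel_change_of_variables[OF _ _ _ _ rel])
      (simp_all add: T_def nn_integral_permute_13_2 del: prod.collapse)
  moreover have "(\<lambda>z. 1 * (case T z of (w, v) \<Rightarrow> k w * l v)) = (\<lambda>(p, q, s). k (p, s) * l q)" for k l :: "_ \<Rightarrow> complex"
    by (auto simp: T_def fun_eq_iff)
  ultimately show "l2_rel (\<lambda>(p, q, s). f (p, s) * g q) (\<lambda>(p, q, s). f' (p, s) * g' q)"
    by (simp only:)
qed

lift_definition tensor23 :: "('a::euclidean_space \<times> 'a) l2 \<Rightarrow> 'a l2 \<Rightarrow> ('a \<times> 'a \<times> 'a) l2"
  is "\<lambda>\<xi> \<zeta> (p, q, s). \<xi> (q, s) * \<zeta> p"
proof -
  fix f f' :: "'a \<times> 'a \<Rightarrow> complex" and g g' :: "'a \<Rightarrow> complex"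
  assume "l2_rel f f'" "l2_rel g g'"
  then have rel: "l2_rel (\<lambda>(w, v). f w * g v) (\<lambda>(w, v). f' w * g' v)"
    by (rule l2_rel_tensor)
  define T :: "'a \<times> 'a \<times> 'a \<Rightarrow> ('a \<times> 'a) \<times> 'a" where
    "T z = ((fst (snd z), snd (snd z)), fst z)" for z
  have "T \<in> borel_measurable borel"
    unfolding T_def by measurable
  then have "l2_rel (\<lambda>z. 1 * (case T z of (w, v) \<Rightarrow> f w * g v)) (\<lambda>z. 1 * (case T z of (w, v) \<Rightarrow> f' w * g' v))"
    by (rule l2_rel_change_of_variables[OF _ _ _ _ rel])
      (simp_all add: T_def nn_integral_permute_23_1 del: prod.collapse)
  moreover have "(\<lambda>z. 1 * (case T z of (w, v) \<Rightarrow> k w * l v)) = (\<lambda>(p, q, s). k (q, s) * l p)" for k l :: "_ \<Rightarrow> complex"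
    by (auto simp: T_def fun_eq_iff)
  ultimately show "l2_rel (\<lambda>(p, q, s). f (q, s) * g p) (\<lambda>(p, q, s). f' (q, s) * g' p)"
    by (simp only:)
qed

text \<open>
  \<open>leg tensor12 U\<close>, \<open>leg tensor13 U\<close> and \<open>leg tensor23 U\<close> are \<open>U\<^sub>1\<^sub>2 = U \<otimes> 1\<close>, \<open>U\<^sub>1\<^sub>3\<close> and
  \<open>U\<^sub>2\<^sub>3 = 1 \<otimes> U\<close>.  As elementary tensors span a dense subspace, at most one bounded operator acts
  as \<open>U\<close> on the chosen legs and as the identity on the remaining one.
\<close>

definition leg ::
  "(('a::euclidean_space \<times> 'a) l2 \<Rightarrow> 'a l2 \<Rightarrow> ('a \<times> 'a \<times> 'a) l2) \<Rightarrow>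
    (('a \<times> 'a) l2 \<Rightarrow> ('a \<times> 'a) l2) \<Rightarrow> ('a \<times> 'a \<times> 'a) l2 \<Rightarrow> ('a \<times> 'a \<times> 'a) l2" where
  "leg t U = (THE V. bounded_clinear V \<and> (\<forall>\<xi> \<zeta>. V (t \<xi> \<zeta>) = t (U \<xi>) \<zeta>))"

definition pentagon_equation ::
  "(('a::euclidean_space \<times> 'a) l2 \<Rightarrow> ('a \<times> 'a) l2) \<Rightarrow> bool" where
  "pentagon_equation U \<longleftrightarrow>
     leg tensor12 U \<circ> leg tensor13 U \<circ> leg tensor23 U = leg tensor23 U \<circ> leg tensor12 U"


section \<open>The operator\<close>

type_synonym 'n coords = "(real ^ 'n) \<times> (real ^ 'n) \<times> real"

definition ebar :: "real \<Rightarrow> complex" where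
  "ebar t = exp (- 2 * complex_of_real pi * \<i> * complex_of_real t)"

definition eta :: "real \<Rightarrow> real \<Rightarrow> real" where
  "eta lam r = (exp (2 * lam * r) - 1) / (2 * lam)"

definition U_fun ::
  "real \<Rightarrow> ('n::finite coords \<times> 'n coords \<Rightarrow> complex) \<Rightarrow> 'n coords \<times> 'n coords \<Rightarrow> complex" where
  "U_fun lam \<xi> = (\<lambda>((x, y, r), (x', y', r')).
     complex_of_real (exp (- lam * r') ^ CARD('n))
     * ebar (eta lam r' * inner (exp (- lam * r') *\<^sub>R x) (y' - exp (- lam * r') *\<^sub>R y))
     * \<xi> ((exp (- lam * r') *\<^sub>R x, exp (- lam * r') *\<^sub>R y, r + r'),
          (x' - exp (- lam * r') *\<^sub>R x, y' - exp (- lam * r') *\<^sub>R y, r')))"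

lemma nn_integral_dilate_coords:
  fixes h :: "'n::finite coords \<Rightarrow> ennreal"
  assumes [measurable]: "h \<in> borel_measurable borel" and c: "c > 0"
  shows "(\<integral>\<^sup>+p. ennreal ((c ^ CARD('n))\<^sup>2) * h (c *\<^sub>R fst p, c *\<^sub>R fst (snd p), snd (snd p) + t) \<partial>lborel)
    = (\<integral>\<^sup>+p. h p \<partial>lborel)"
proof -
  have r: "(\<integral>\<^sup>+r. h (x, y, r + t) \<partial>lborel) = (\<integral>\<^sup>+r. h (x, y, r) \<partial>lborel)" for x y
    using nn_integral_lborel_affine[of "\<lambda>r. h (x, y, r)" 1 t] by (simp add: add.commute)
  have "(\<integral>\<^sup>+p. ennreal ((c ^ CARD('n))\<^sup>2) * h (c *\<^sub>R fst p, c *\<^sub>R fst (snd p), snd (snd p) + t) \<partial>lborel)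
      = (\<integral>\<^sup>+x. \<integral>\<^sup>+y. \<integral>\<^sup>+r. ennreal (c ^ CARD('n)) * (ennreal (c ^ CARD('n))
           * h (c *\<^sub>R x, c *\<^sub>R y, r + t)) \<partial>lborel \<partial>lborel \<partial>lborel)"
    using c by (simp add: nn_integral_lborel_Pair power2_eq_square ennreal_mult mult.assoc)
  also have "\<dots> = (\<integral>\<^sup>+x. ennreal (c ^ CARD('n)) * (\<integral>\<^sup>+y. ennreal (c ^ CARD('n))
           * (\<integral>\<^sup>+r. h (c *\<^sub>R x, c *\<^sub>R y, r) \<partial>lborel) \<partial>lborel) \<partial>lborel)"
    by (simp add: nn_integral_cmult r)
  also have "\<dots> = (\<integral>\<^sup>+x. ennreal (c ^ CARD('n)) * (\<integral>\<^sup>+y. \<integral>\<^sup>+r. h (c *\<^sub>R x, y, r) \<partial>lborel \<partial>lborel) \<partial>lborel)"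
    using nn_integral_lborel_affine[of "\<lambda>y. \<integral>\<^sup>+r. h (c *\<^sub>R x, y, r) \<partial>lborel" c 0 for x] c by simp
  also have "\<dots> = (\<integral>\<^sup>+x. \<integral>\<^sup>+y. \<integral>\<^sup>+r. h (x, y, r) \<partial>lborel \<partial>lborel \<partial>lborel)"
    using nn_integral_lborel_affine[of "\<lambda>x. \<integral>\<^sup>+y. \<integral>\<^sup>+r. h (x, y, r) \<partial>lborel \<partial>lborel" c 0] c by simp
  also have "\<dots> = (\<integral>\<^sup>+p. h p \<partial>lborel)"
    by (simp add: nn_integral_lborel_Pair)
  finally show ?thesis .
qed

lemma nn_integral_shift_coords:
  fixes h :: "'n::finite coords \<times> 'n coords \<Rightarrow> ennreal"
  assumes [measurable]: "h \<in> borel_measurable borel"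
  shows "(\<integral>\<^sup>+z. h (fst z, snd z - (fst (fst z), fst (snd (fst z)), 0)) \<partial>lborel) = (\<integral>\<^sup>+z. h z \<partial>lborel)"
proof -
  have "(\<integral>\<^sup>+q. h (p, q - t) \<partial>lborel) = (\<integral>\<^sup>+q. h (p, q) \<partial>lborel)" for p t
    using nn_integral_lborel_affine[of "\<lambda>q. h (p, q)" 1 "- t"] by simp
  then show ?thesis
    by (simp add: nn_integral_lborel_Pair[where 'a = "'n coords" and 'b = "'n coords"])
qed

lemma nn_integral_U:
  fixes h :: "'n::finite coords \<times> 'n coords \<Rightarrow> ennreal"
  assumes [measurable]: "h \<in> borel_measurable borel"
  shows "(\<integral>\<^sup>+z. ennreal ((exp (- lam * snd (snd (snd z))) ^ CARD('n))\<^sup>2)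
      * h (let a = exp (- lam * snd (snd (snd z))) in
            ((a *\<^sub>R fst (fst z), a *\<^sub>R fst (snd (fst z)), snd (snd (fst z)) + snd (snd (snd z))),
             (fst (snd z) - a *\<^sub>R fst (fst z), fst (snd (snd z)) - a *\<^sub>R fst (snd (fst z)), snd (snd (snd z)))))
      \<partial>lborel) = (\<integral>\<^sup>+z. h z \<partial>lborel)" (is "?L = _")
proof -
  define k where "k z = h (fst z, snd z - (fst (fst z), fst (snd (fst z)), 0))" for z
  define D where "D q p = (exp (- lam * snd (snd q)) *\<^sub>R fst p, exp (- lam * snd (snd q)) *\<^sub>R fst (snd p),
    snd (snd p) + snd (snd q))" for p q :: "'n coords"
  define w where "w q = ennreal ((exp (- lam * snd (snd q)) ^ CARD('n))\<^sup>2)" for q :: "'n coords"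
  have k [measurable]: "k \<in> borel_measurable borel"
    unfolding k_def by measurable
  have m: "(\<lambda>z. w (snd z) * k (D (snd z) (fst z), snd z)) \<in> borel_measurable borel"
    unfolding w_def D_def by measurable
  have "?L = (\<integral>\<^sup>+z. w (snd z) * k (D (snd z) (fst z), snd z) \<partial>lborel)"
    unfolding w_def D_def k_def Let_def
    by (simp only: fst_conv snd_conv fst_diff snd_diff minus_prod_def diff_0_right)
  also have "\<dots> = (\<integral>\<^sup>+q. \<integral>\<^sup>+p. w q * k (D q p, q) \<partial>lborel \<partial>lborel)"
    unfolding nn_integral_lborel_Pair_swap[OF m] by (simp only: fst_conv snd_conv)
  also have "\<dots> = (\<integral>\<^sup>+q. \<integral>\<^sup>+p. k (p, q) \<partial>lborel \<partial>lborel)"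
  proof (rule nn_integral_cong)
    fix q :: "'n coords"
    have "(\<lambda>p. k (p, q)) \<in> borel_measurable borel"
      by measurable
    from nn_integral_dilate_coords[OF this exp_gt_zero]
    show "(\<integral>\<^sup>+p. w q * k (D q p, q) \<partial>lborel) = (\<integral>\<^sup>+p. k (p, q) \<partial>lborel)"
      unfolding w_def D_def .
  qed
  also have "\<dots> = (\<integral>\<^sup>+z. k z \<partial>lborel)"
    by (rule nn_integral_lborel_Pair_swap[OF k, symmetric])
  also have "\<dots> = (\<integral>\<^sup>+z. h z \<partial>lborel)"
    unfolding k_def by (rule nn_integral_shift_coords) measurable
  finally show ?thesis .
qed

lift_definition U_op :: "real \<Rightarrow> ('n::finite coords \<times> 'n coords) l2 \<Rightarrow> ('n coords \<times> 'n coords) l2"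
  is U_fun
proof -
  fix lam :: real and f g :: "'n coords \<times> 'n coords \<Rightarrow> complex"
  assume rel: "l2_rel f g"
  define T :: "'n coords \<times> 'n coords \<Rightarrow> 'n coords \<times> 'n coords" where
    "T z = (let a = exp (- lam * snd (snd (snd z))) in
            ((a *\<^sub>R fst (fst z), a *\<^sub>R fst (snd (fst z)), snd (snd (fst z)) + snd (snd (snd z))),
             (fst (snd z) - a *\<^sub>R fst (fst z), fst (snd (snd z)) - a *\<^sub>R fst (snd (fst z)), snd (snd (snd z)))))"
    for z
  define u :: "'n coords \<times> 'n coords \<Rightarrow> complex" where
    "u z = (let a = exp (- lam * snd (snd (snd z))) in
       complex_of_real (a ^ CARD('n))
       * ebar (eta lam (snd (snd (snd z)))
           * inner (a *\<^sub>R fst (fst z)) (fst (snd (snd z)) - a *\<^sub>R fst (snd (fst z)))))" for z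
  have U_eq: "U_fun lam k = (\<lambda>z. u z * k (T z))" for k
    by (auto simp: U_fun_def u_def T_def Let_def)
  have norm_u: "cmod (u z) = exp (- lam * snd (snd (snd z))) ^ CARD('n)" for z
    by (simp add: u_def Let_def ebar_def norm_mult norm_power)
  show "l2_rel (U_fun lam f) (U_fun lam g)"
    unfolding U_eq
  proof (rule l2_rel_change_of_variables[OF _ _ _ _ rel])
    show "T \<in> borel_measurable borel"
      unfolding T_def Let_def by measurable
    show "u \<in> borel_measurable borel"
      unfolding u_def Let_def ebar_def eta_def by measurable
    show "u z \<noteq> 0" for z
    proof -
      have "0 < cmod (u z)"
        unfolding norm_u by simp
      then show ?thesis
        by auto
    qed
    fix h :: "'n coords \<times> 'n coords \<Rightarrow> ennreal"
    assume "h \<in> borel_measurable borel"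
    then show "(\<integral>\<^sup>+z. ennreal ((cmod (u z))\<^sup>2) * h (T z) \<partial>lborel) = (\<integral>\<^sup>+w. h w \<partial>lborel)"
      unfolding norm_u T_def by (rule nn_integral_U)
  qed
qed

end

theory Submission
  imports Defs
begin

text \<open>
  \<open>U\<close> is a weighted composition operator \<open>\<xi> \<mapsto> u \<cdot> (\<xi> \<circ> T)\<close>, where \<open>\<bar>u\<bar>\<^sup>2\<close> is the Jacobian of the
  invertible map \<open>T\<close>; hence it is unitary.  Such an operator extends to each pair of legs of the triple
  product, again as a weighted composition operator, and the extension is the only one because
  elementary tensors are total: the functions killed by a bounded operator vanishing on them include
  the indicators of bounded rectangles, hence by Dynkin's lemma and dominated convergence all of
  \<open>L\<^sup>2\<close>.  Both sides of the pentagon are then weighted composition operators, and it remains to compare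
  the two maps and the two weights pointwise.  The phases agree because \<open>eta\<close> is a cocycle,
  \<open>eta lam (r + s) = eta lam s + exp (2 lam s) eta lam r\<close>.
\<close>

section \<open>Classes of square-integrable functions\<close>

lemma l2_rel_refl_iff: "l2_rel f f \<longleftrightarrow> square_integrable f"
  by (simp add: l2_rel_def)

lemma rep_l2_square_integrable: "square_integrable (rep_l2 F)"
  using Quotient_rep_reflp[OF Quotient_l2] by (simp add: l2_rel_refl_iff)

lemma abs_rep_l2: "abs_l2 (rep_l2 F) = F"
  by (rule Quotient_abs_rep[OF Quotient_l2])

lemma abs_l2_cases:
  obtains f where "square_integrable f" "F = abs_l2 f"
  using rep_l2_square_integrable abs_rep_l2 by metis

lemma l2_rel_rep_abs: "square_integrable f \<Longrightarrow> l2_rel (rep_l2 (abs_l2 f)) f"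
  by (rule Quotient_rep_abs[OF Quotient_l2]) (simp add: l2_rel_refl_iff)

lemma square_integrable_measurable [dest]:
  "square_integrable f \<Longrightarrow> f \<in> borel_measurable borel"
  by (simp add: square_integrable_def)

lemma square_integrable_diff:
  "square_integrable f \<Longrightarrow> square_integrable g \<Longrightarrow> square_integrable (\<lambda>x. f x - g x)"
  using square_integrable_add[of f "\<lambda>x. -1 * g x"] square_integrable_cmult[of g "-1"] by simp

lemma square_integrable_bound:
  assumes "square_integrable g" "f \<in> borel_measurable borel" "\<And>x. cmod (f x) \<le> c * cmod (g x)"
  shows "square_integrable f"
proof -
  have *: "integrable lborel (\<lambda>x. c\<^sup>2 * (cmod (g x))\<^sup>2)"
    using assms by (simp add: square_integrable_def)
  have "(cmod (f x))\<^sup>2 \<le> c\<^sup>2 * (cmod (g x))\<^sup>2" for x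
    using power_mono[OF assms(3)[of x], of 2] by (simp add: power_mult_distrib)
  then show ?thesis
    using assms(2) unfolding square_integrable_def
    by (intro conjI Bochner_Integration.integrable_bound[OF *]) auto
qed

lemma square_integrable_nn_integral:
  assumes "f \<in> borel_measurable borel"
  shows "square_integrable f \<longleftrightarrow> (\<integral>\<^sup>+x. ennreal ((cmod (f x))\<^sup>2) \<partial>lborel) < \<infinity>"
  using assms by (auto simp: square_integrable_def integrable_iff_bounded)

lemma square_integrable_indicator:
  assumes "A \<in> sets borel" "emeasure lborel A < \<infinity>"
  shows "square_integrable (indicator A)"
proof -
  have "(\<integral>\<^sup>+x. ennreal ((cmod (indicator A x))\<^sup>2) \<partial>lborel) = (\<integral>\<^sup>+x. indicator A x \<partial>lborel)"
    by (intro nn_integral_cong) (auto simp: indicator_def)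
  with assms show ?thesis
    by (subst square_integrable_nn_integral) auto
qed

lemma abs_l2_add:
  "square_integrable f \<Longrightarrow> square_integrable g \<Longrightarrow> abs_l2 f + abs_l2 g = abs_l2 (\<lambda>x. f x + g x)"
  by (rule plus_l2.abs_eq) (simp_all add: l2_rel_refl_iff)

lemma abs_l2_scaleC: "square_integrable f \<Longrightarrow> c *\<^sub>C abs_l2 f = abs_l2 (\<lambda>x. c * f x)"
  by (rule scaleC.abs_eq) (simp add: l2_rel_refl_iff)

lemma abs_l2_diff:
  assumes "square_integrable f" "square_integrable g"
  shows "abs_l2 f - abs_l2 g = abs_l2 (\<lambda>x. f x - g x)"
  using assms abs_l2_add[of f "\<lambda>x. -1 * g x"] square_integrable_cmult[of g "-1"]
  by (simp add: minus_l2_def uminus_l2.abs_eq l2_rel_refl_iff)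

lemma abs_l2_zero: "abs_l2 (\<lambda>_. 0) = 0"
  by (rule zero_l2.abs_eq[symmetric])

lemma cinner_abs_l2:
  "square_integrable f \<Longrightarrow> square_integrable g \<Longrightarrow>
    cinner (abs_l2 f) (abs_l2 g) = (\<integral>x. f x * cnj (g x) \<partial>lborel)"
  by (rule cinner.abs_eq) (simp_all add: l2_rel_refl_iff)

text \<open>The norm comes from the real inner product, while unitarity is stated with
  \<open>cinner\<close>; this lets preservation of the latter control the former.\<close>

lemma inner_l2_eq_Re_cinner: "inner F G = Re (cinner F G)"
proof (transfer, unfold inner_complex_eq_Re)
  fix f g :: "'a \<Rightarrow> complex"
  assume "l2_rel f f" "l2_rel g g"
  then show "(\<integral>x. Re (f x * cnj (g x)) \<partial>lborel) = Re (\<integral>x. f x * cnj (g x) \<partial>lborel)"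
    using integral_Re integrable_mult_cnj unfolding l2_rel_refl_iff by blast
qed

lemma norm_abs_l2:
  "square_integrable f \<Longrightarrow> norm (abs_l2 f) = sqrt (\<integral>x. (cmod (f x))\<^sup>2 \<partial>lborel)"
  by (simp add: norm_eq_sqrt_inner inner_l2.abs_eq l2_rel_refl_iff power2_norm_eq_inner)

text \<open>Preserving \<open>cinner\<close> preserves the norm by
  \<open>inner_l2_eq_Re_cinner\<close>, so the operator bound is 1. Real homogeneity is a case of
  complex homogeneity, because \<open>scaleR\<close> is defined through
  \<open>scaleC\<close>.\<close>

lemma bounded_clinear_isometry:
  assumes "\<And>F G. T (F + G) = T F + T G" "\<And>c F. T (c *\<^sub>C F) = c *\<^sub>C T F"
    "\<And>F G. cinner (T F) (T G) = cinner F G"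
  shows "bounded_clinear T"
proof -
  have "norm (T F) = norm F" for F
    by (simp add: norm_eq_sqrt_inner inner_l2_eq_Re_cinner assms(3))
  then show ?thesis
    unfolding bounded_clinear_def
    by (auto intro!: bounded_linear_intro[where K = 1] simp: assms scaleR_l2_def)
qed

text \<open>The limit inherits the bound \<open>c * cmod (g x)\<close>, so |f_i - h|^2 is dominated
  by the integrable function (2c)^2 |g|^2. Dominated convergence for these squares is convergence in
  the L2 norm.\<close>

lemma tendsto_abs_l2_dominated:
  assumes g: "square_integrable g"
    and f: "\<And>i. f i \<in> borel_measurable borel" "\<And>i x. cmod (f i x) \<le> c * cmod (g x)"
    and lim: "\<And>x. (\<lambda>i. f i x) \<longlonglongrightarrow> h x"
  shows "square_integrable h" "(\<lambda>i. abs_l2 (f i)) \<longlonglongrightarrow> abs_l2 h"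
proof -
  have [measurable]: "g \<in> borel_measurable borel"
    using g by auto
  note [measurable] = f(1)
  have h_bound: "cmod (h x) \<le> c * cmod (g x)" for x
    by (rule LIMSEQ_le_const2[OF tendsto_norm[OF lim[of x]]]) (use f(2) in auto)
  have [measurable]: "h \<in> borel_measurable borel"
    by (rule borel_measurable_LIMSEQ_metric[OF f(1) lim])
  show h: "square_integrable h"
    by (rule square_integrable_bound[OF g _ h_bound]) simp
  have fi: "square_integrable (f i)" for i
    by (rule square_integrable_bound[OF g _ f(2)]) simp
  have "(\<lambda>i. \<integral>x. (cmod (f i x - h x))\<^sup>2 \<partial>lborel) \<longlonglongrightarrow> (\<integral>x. 0 \<partial>(lborel :: 'a measure))"
  proof (rule integral_dominated_convergence[where w = "\<lambda>x. (2 * c)\<^sup>2 * (cmod (g x))\<^sup>2"])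
    show "integrable lborel (\<lambda>x. (2 * c)\<^sup>2 * (cmod (g x))\<^sup>2)"
      using g by (simp add: square_integrable_def)
    show "AE x in lborel. (\<lambda>i. (cmod (f i x - h x))\<^sup>2) \<longlonglongrightarrow> 0"
    proof (rule AE_I2)
      fix x
      have "(\<lambda>i. (cmod (f i x - h x))\<^sup>2) \<longlonglongrightarrow> (cmod (h x - h x))\<^sup>2"
        by (intro tendsto_intros lim)
      then show "(\<lambda>i. (cmod (f i x - h x))\<^sup>2) \<longlonglongrightarrow> 0"
        by simp
    qed
    show "AE x in lborel. norm ((cmod (f i x - h x))\<^sup>2) \<le> (2 * c)\<^sup>2 * (cmod (g x))\<^sup>2" for i
    proof (rule AE_I2)
      fix x
      have "cmod (f i x - h x) \<le> 2 * c * cmod (g x)"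
        using norm_triangle_ineq4[of "f i x" "h x"] f(2)[of i x] h_bound[of x] by linarith
      then show "norm ((cmod (f i x - h x))\<^sup>2) \<le> (2 * c)\<^sup>2 * (cmod (g x))\<^sup>2"
        using power_mono[of _ _ 2] by (fastforce simp: power_mult_distrib)
    qed
  qed simp_all
  then have "(\<lambda>i. sqrt (\<integral>x. (cmod (f i x - h x))\<^sup>2 \<partial>lborel)) \<longlonglongrightarrow> sqrt 0"
    by (intro tendsto_real_sqrt) simp
  then have "(\<lambda>i. norm (abs_l2 (f i) - abs_l2 h)) \<longlonglongrightarrow> 0"
    by (simp add: abs_l2_diff norm_abs_l2 square_integrable_diff fi h)
  then show "(\<lambda>i. abs_l2 (f i)) \<longlonglongrightarrow> abs_l2 h"
    by (rule LIM_zero_cancel[OF tendsto_norm_zero_cancel])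
qed


section \<open>Weighted composition operators\<close>

text \<open>The integral condition says that \<open>T\<close> pushes the measure with density |u|^2
  forward to Lebesgue measure, so |u|^2 plays the role of the Jacobian. As \<open>u\<close> vanishes
  nowhere, preimages of null sets under \<open>T\<close> are null.\<close>

definition weighted_measure_preserving ::
  "('a::euclidean_space \<Rightarrow> complex) \<Rightarrow> ('a \<Rightarrow> 'b::euclidean_space) \<Rightarrow> bool" where
  "weighted_measure_preserving u T \<longleftrightarrow>
     T \<in> borel_measurable borel \<and> u \<in> borel_measurable borel \<and> (\<forall>z. u z \<noteq> 0) \<and>
     (\<forall>h \<in> borel_measurable borel.
        (\<integral>\<^sup>+z. ennreal ((cmod (u z))\<^sup>2) * h (T z) \<partial>lborel) = (\<integral>\<^sup>+w. h w \<partial>lborel))"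

text \<open>The fixed representative makes this total in \<open>u\<close> and \<open>T\<close>; for
  a weighted measure preserving pair every representative gives the same class, by
  \<open>wcomp_abs\<close>.\<close>

definition wcomp ::
  "('a::euclidean_space \<Rightarrow> complex) \<Rightarrow> ('a \<Rightarrow> 'b::euclidean_space) \<Rightarrow> 'b l2 \<Rightarrow> 'a l2" where
  "wcomp u T F = abs_l2 (\<lambda>z. u z * rep_l2 F (T z))"

lemma weighted_measure_preservingD:
  assumes "weighted_measure_preserving u T"
  shows "T \<in> borel_measurable borel" "u \<in> borel_measurable borel" "u z \<noteq> 0"
    "h \<in> borel_measurable borel \<Longrightarrow>
      (\<integral>\<^sup>+z. ennreal ((cmod (u z))\<^sup>2) * h (T z) \<partial>lborel) = (\<integral>\<^sup>+w. h w \<partial>lborel)"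
  using assms unfolding weighted_measure_preserving_def by blast+

lemma l2_rel_wcomp:
  assumes "weighted_measure_preserving u T" "l2_rel f g"
  shows "l2_rel (\<lambda>z. u z * f (T z)) (\<lambda>z. u z * g (T z))"
  using weighted_measure_preservingD[OF assms(1)] assms(2) by (rule l2_rel_change_of_variables)

lemma square_integrable_wcomp:
  "weighted_measure_preserving u T \<Longrightarrow> square_integrable f \<Longrightarrow> square_integrable (\<lambda>z. u z * f (T z))"
  using l2_rel_wcomp[of u T f f] by (simp add: l2_rel_refl_iff)

lemma wcomp_abs:
  assumes "weighted_measure_preserving u T" "square_integrable f"
  shows "wcomp u T (abs_l2 f) = abs_l2 (\<lambda>z. u z * f (T z))"
  unfolding wcomp_def
  by (rule Quotient_rel_abs[OF Quotient_l2], rule l2_rel_wcomp[OF assms(1)])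
    (rule l2_rel_rep_abs[OF assms(2)])

text \<open>Test the defining condition on indicators. Equality of measures carries the change of
  variables from nonnegative integrands to the complex ones in \<open>cinner\<close>.\<close>

lemma lborel_eq_distr_density:
  assumes "weighted_measure_preserving u T"
  shows "lborel = distr (density lborel (\<lambda>z. ennreal ((cmod (u z))\<^sup>2))) borel T"
proof (rule measure_eqI)
  note [measurable] = weighted_measure_preservingD(1,2)[OF assms]
  fix A :: "'b set"
  assume "A \<in> sets lborel"
  then have [measurable]: "A \<in> sets borel"
    by simp
  have [measurable]: "T -` A \<in> sets borel"
    using measurable_sets[of T borel borel A] by simp
  have "emeasure (distr (density lborel (\<lambda>z. ennreal ((cmod (u z))\<^sup>2))) borel T) A
      = (\<integral>\<^sup>+z. ennreal ((cmod (u z))\<^sup>2) * indicator (T -` A) z \<partial>lborel)"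
    by (simp add: emeasure_distr emeasure_density)
  also have "\<dots> = (\<integral>\<^sup>+z. ennreal ((cmod (u z))\<^sup>2) * indicator A (T z) \<partial>lborel)"
    by (intro nn_integral_cong) (simp add: indicator_def)
  also have "\<dots> = emeasure lborel A"
    by (subst weighted_measure_preservingD(4)[OF assms]) auto
  finally show "emeasure lborel A
      = emeasure (distr (density lborel (\<lambda>z. ennreal ((cmod (u z))\<^sup>2))) borel T) A"
    by simp
qed simp

text \<open>The change of variables produces the factor |u|^2, which equals u times its conjugate
  and is shared between the two arguments.\<close>

lemma cinner_wcomp:
  assumes uT: "weighted_measure_preserving u T"
  shows "cinner (wcomp u T F) (wcomp u T G) = cinner F G"
proof -
  note [measurable] = weighted_measure_preservingD(1,2)[OF uT]
  obtain f where f: "square_integrable f" "F = abs_l2 f" by (rule abs_l2_cases)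
  obtain g where g: "square_integrable g" "G = abs_l2 g" by (rule abs_l2_cases)
  have [measurable]: "f \<in> borel_measurable borel" "g \<in> borel_measurable borel"
    using f g by auto
  have "(\<integral>w. f w * cnj (g w) \<partial>lborel)
      = (\<integral>z. (cmod (u z))\<^sup>2 *\<^sub>R (f (T z) * cnj (g (T z))) \<partial>lborel)"
    by (subst lborel_eq_distr_density[OF uT], subst integral_distr) (auto simp: integral_density)
  also have "\<dots> = (\<integral>z. (u z * f (T z)) * cnj (u z * g (T z)) \<partial>lborel)"
  proof (rule Bochner_Integration.integral_cong[OF refl])
    fix z
    have "complex_of_real ((cmod (u z))\<^sup>2) = u z * cnj (u z)"
      by (rule complex_norm_square)
    then show "(cmod (u z))\<^sup>2 *\<^sub>R (f (T z) * cnj (g (T z))) = (u z * f (T z)) * cnj (u z * g (T z))"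
      by (simp add: scaleR_conv_of_real ac_simps)
  qed
  finally show ?thesis
    by (simp add: f g wcomp_abs[OF uT] cinner_abs_l2 square_integrable_wcomp[OF uT])
qed

lemma bounded_clinear_wcomp:
  assumes uT: "weighted_measure_preserving u T"
  shows "bounded_clinear (wcomp u T)"
proof (rule bounded_clinear_isometry)
  fix F G :: "'b l2" and c
  obtain f where f: "square_integrable f" "F = abs_l2 f" by (rule abs_l2_cases)
  obtain g where g: "square_integrable g" "G = abs_l2 g" by (rule abs_l2_cases)
  show "wcomp u T (F + G) = wcomp u T F + wcomp u T G"
    by (simp add: f g abs_l2_add wcomp_abs[OF uT] square_integrable_wcomp[OF uT]
        square_integrable_add distrib_left)
  show "wcomp u T (c *\<^sub>C F) = c *\<^sub>C wcomp u T F"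
    by (simp add: f abs_l2_scaleC wcomp_abs[OF uT] square_integrable_wcomp[OF uT]
        square_integrable_cmult mult.left_commute)
qed (rule cinner_wcomp[OF uT])

text \<open>Jacobians multiply along a composition: the condition for \<open>T\<close> is applied to
  |v|^2 (h \<circ> S), then the one for \<open>S\<close> to h.\<close>

lemma weighted_measure_preserving_comp:
  assumes uT: "weighted_measure_preserving u T" and vS: "weighted_measure_preserving v S"
  shows "weighted_measure_preserving (\<lambda>z. u z * v (T z)) (\<lambda>z. S (T z))"
  unfolding weighted_measure_preserving_def
proof (intro conjI allI ballI)
  note [measurable] = weighted_measure_preservingD(1,2)[OF uT] weighted_measure_preservingD(1,2)[OF vS]
  show "(\<lambda>z. S (T z)) \<in> borel_measurable borel" "(\<lambda>z. u z * v (T z)) \<in> borel_measurable borel"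
    by measurable
  show "u z * v (T z) \<noteq> 0" for z
    using weighted_measure_preservingD(3)[OF uT] weighted_measure_preservingD(3)[OF vS] by simp
  fix h :: "'c \<Rightarrow> ennreal"
  assume [measurable]: "h \<in> borel_measurable borel"
  have "(\<integral>\<^sup>+z. ennreal ((cmod (u z * v (T z)))\<^sup>2) * h (S (T z)) \<partial>lborel)
      = (\<integral>\<^sup>+z. ennreal ((cmod (u z))\<^sup>2) * (ennreal ((cmod (v (T z)))\<^sup>2) * h (S (T z))) \<partial>lborel)"
    by (simp add: norm_mult power_mult_distrib ennreal_mult mult.assoc)
  also have "\<dots> = (\<integral>\<^sup>+w. ennreal ((cmod (v w))\<^sup>2) * h (S w) \<partial>lborel)"
    by (rule weighted_measure_preservingD(4)[OF uT]) measurable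
  also have "\<dots> = (\<integral>\<^sup>+w. h w \<partial>lborel)"
    by (rule weighted_measure_preservingD(4)[OF vS]) measurable
  finally show "(\<integral>\<^sup>+z. ennreal ((cmod (u z * v (T z)))\<^sup>2) * h (S (T z)) \<partial>lborel)
      = (\<integral>\<^sup>+w. h w \<partial>lborel)" .
qed

text \<open>Pullback reverses composition: in a product of operators the map of the leftmost factor
  acts first, and later weights are evaluated along its image.\<close>

lemma wcomp_wcomp:
  assumes uT: "weighted_measure_preserving u T" and vS: "weighted_measure_preserving v S"
  shows "wcomp u T (wcomp v S F) = wcomp (\<lambda>z. u z * v (T z)) (\<lambda>z. S (T z)) F"
proof -
  obtain f where f: "square_integrable f" "F = abs_l2 f" by (rule abs_l2_cases)
  show ?thesis
    by (simp add: f wcomp_abs uT vS weighted_measure_preserving_comp[OF uT vS]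
        square_integrable_wcomp[OF vS] mult.assoc)
qed

text \<open>A preimage of f is (f / u) \<circ> S, since S \<circ> T is the identity. The change of
  variables gives it the same L2 norm as f.\<close>

lemma surj_wcomp:
  assumes uT: "weighted_measure_preserving u T"
    and S [measurable]: "S \<in> borel_measurable borel" and ST: "\<And>z. S (T z) = z"
  shows "surj (wcomp u T)"
proof (rule surjI)
  fix F :: "'a l2"
  define f where "f = rep_l2 F"
  have f: "square_integrable f" "F = abs_l2 f"
    by (simp_all add: f_def rep_l2_square_integrable abs_rep_l2)
  note [measurable] = weighted_measure_preservingD(1,2)[OF uT]
  have [measurable]: "f \<in> borel_measurable borel"
    using f by auto
  define g where "g = (\<lambda>w. f (S w) / u (S w))"
  have g_meas [measurable]: "g \<in> borel_measurable borel"
    unfolding g_def by measurable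
  have g_eq: "u z * g (T z) = f z" for z
    using weighted_measure_preservingD(3)[OF uT, of z] by (simp add: g_def ST)
  have "(\<integral>\<^sup>+w. ennreal ((cmod (g w))\<^sup>2) \<partial>lborel)
      = (\<integral>\<^sup>+z. ennreal ((cmod (u z))\<^sup>2) * ennreal ((cmod (g (T z)))\<^sup>2) \<partial>lborel)"
    by (rule weighted_measure_preservingD(4)[OF uT, symmetric]) measurable
  also have "\<dots> = (\<integral>\<^sup>+z. ennreal ((cmod (u z * g (T z)))\<^sup>2) \<partial>lborel)"
    by (simp add: norm_mult power_mult_distrib ennreal_mult)
  also have "\<dots> = (\<integral>\<^sup>+z. ennreal ((cmod (f z))\<^sup>2) \<partial>lborel)"
    by (simp only: g_eq)
  also have "\<dots> < \<infinity>"
    using f by (simp add: square_integrable_nn_integral)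
  finally have "square_integrable g"
    by (simp add: square_integrable_nn_integral)
  then show "wcomp u T (abs_l2 (\<lambda>w. rep_l2 F (S w) / u (S w))) = F"
    unfolding f_def[symmetric] g_def[symmetric] by (simp add: wcomp_abs[OF uT] g_eq f)
qed

text \<open>Invariance under \<open>T\<close>, applied to h \<circ> S, reads as invariance under
  \<open>S\<close> because S \<circ> T is the identity.\<close>

lemma weighted_measure_preserving_inverse:
  assumes T: "weighted_measure_preserving (\<lambda>_. 1) T"
    and S: "S \<in> borel_measurable borel" and ST: "\<And>z. S (T z) = z"
  shows "weighted_measure_preserving (\<lambda>_. 1) S"
  unfolding weighted_measure_preserving_def
proof (intro conjI allI ballI S)
  note [measurable] = S
  fix h :: "'a \<Rightarrow> ennreal"
  assume [measurable]: "h \<in> borel_measurable borel"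
  have "(\<lambda>w. h (S w)) \<in> borel_measurable borel"
    by measurable
  from weighted_measure_preservingD(4)[OF T this]
  show "(\<integral>\<^sup>+z. ennreal ((cmod 1)\<^sup>2) * h (S z) \<partial>lborel) = (\<integral>\<^sup>+w. h w \<partial>lborel)"
    by (simp add: ST)
qed simp_all

text \<open>By Tonelli the first coordinate may be integrated innermost; for a fixed second
  coordinate the claim is the hypothesis on \<open>u\<close> and \<open>T\<close>.\<close>

lemma weighted_measure_preserving_fst:
  fixes u :: "'a::euclidean_space \<Rightarrow> complex" and T :: "'a \<Rightarrow> 'b::euclidean_space"
  assumes uT: "weighted_measure_preserving u T"
  shows "weighted_measure_preserving (\<lambda>z :: 'a \<times> 'c::euclidean_space. u (fst z)) (\<lambda>z. (T (fst z), snd z))"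
  unfolding weighted_measure_preserving_def
proof (intro conjI allI ballI)
  note [measurable] = weighted_measure_preservingD(1,2)[OF uT]
  show "(\<lambda>z :: 'a \<times> 'c. u (fst z)) \<in> borel_measurable borel"
    "(\<lambda>z :: 'a \<times> 'c. (T (fst z), snd z)) \<in> borel_measurable borel"
    by measurable
  show "u (fst z) \<noteq> 0" for z :: "'a \<times> 'c"
    by (rule weighted_measure_preservingD(3)[OF uT])
  fix h :: "'b \<times> 'c \<Rightarrow> ennreal"
  assume [measurable]: "h \<in> borel_measurable borel"
  have m: "(\<lambda>x. h (x, y)) \<in> borel_measurable borel" for y
    by measurable
  show "(\<integral>\<^sup>+z. ennreal ((cmod (u (fst z)))\<^sup>2) * h (T (fst z), snd z) \<partial>lborel) = (\<integral>\<^sup>+w. h w \<partial>lborel)"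
    using weighted_measure_preservingD(4)[OF uT m] by (simp add: nn_integral_lborel_Pair_swap)
qed


section \<open>Density of elementary tensors\<close>

text \<open>The three leg embeddings are this product followed by a coordinate permutation, so the
  density argument is carried out once, here.\<close>

lift_definition tensor ::
  "'a::euclidean_space l2 \<Rightarrow> 'b::euclidean_space l2 \<Rightarrow> ('a \<times> 'b) l2"
  is "\<lambda>f g (p, q). f p * g q"
  by (rule l2_rel_tensor)

lemma tensor_abs:
  "square_integrable f \<Longrightarrow> square_integrable g \<Longrightarrow>
    tensor (abs_l2 f) (abs_l2 g) = abs_l2 (\<lambda>z. f (fst z) * g (snd z))"
  by (simp add: tensor.abs_eq l2_rel_refl_iff case_prod_beta')

lemma square_integrable_tensor:
  "square_integrable f \<Longrightarrow> square_integrable g \<Longrightarrow> square_integrable (\<lambda>z. f (fst z) * g (snd z))"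
  using l2_rel_tensor[of f f g g] by (simp add: l2_rel_refl_iff case_prod_beta')

text \<open>The functions killed by \<open>D\<close> are enlarged in stages: bounded rectangles,
  Borel sets inside a bounded rectangle, Borel sets of finite measure, simple functions, all of
  L2.\<close>

lemma bounded_clinear_eq_zero_if_tensor:
  fixes D :: "('a::euclidean_space \<times> 'b::euclidean_space) l2 \<Rightarrow> 'c::euclidean_space l2"
  assumes D: "bounded_clinear D" and D0: "\<And>\<xi> \<zeta>. D (tensor \<xi> \<zeta>) = 0"
  shows "D F = 0"
proof -
  interpret bounded_linear D
    using D by (simp add: bounded_clinear_def)
  have D_scaleC: "D (c *\<^sub>C F) = c *\<^sub>C D F" for c F
    using D by (simp add: bounded_clinear_def)
  have scaleC_zero: "c *\<^sub>C (0 :: 'c l2) = 0" for c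
    using abs_l2_scaleC[OF square_integrable_zero, of c] by (simp add: abs_l2_zero)
  \<comment> \<open>Working with functions instead of classes makes pointwise limits available.
    \<open>N\<close> is closed under linear combinations by linearity of \<open>D\<close>, and under
    dominated pointwise limits by its continuity.\<close>
  define N where "N f \<longleftrightarrow> square_integrable f \<and> D (abs_l2 f) = 0" for f
  have N_sq: "square_integrable f" if "N f" for f
    using that by (simp add: N_def)
  have N_zero: "N (\<lambda>_. 0)"
    by (simp add: N_def abs_l2_zero zero)
  have N_add: "N (\<lambda>x. f x + g x)" if "N f" "N g" for f g
    using that by (auto simp: N_def square_integrable_add abs_l2_add[symmetric] add)
  have N_diff: "N (\<lambda>x. f x - g x)" if "N f" "N g" for f g
    using that by (auto simp: N_def square_integrable_diff abs_l2_diff[symmetric] diff)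
  have N_cmult: "N (\<lambda>x. c * f x)" if "N f" for f c
    using that
    by (auto simp: N_def square_integrable_cmult abs_l2_scaleC[symmetric] D_scaleC scaleC_zero)
  have N_sum: "N (\<lambda>x. \<Sum>i\<in>I. f i x)" if "\<And>i. i \<in> I \<Longrightarrow> N (f i)" for I :: "'i set" and f
    using that by (induction I rule: infinite_finite_induct) (auto intro: N_add N_zero)
  have N_lim: "N h" if g: "square_integrable g" and f: "\<And>i. N (f i)"
    and bound: "\<And>i x. cmod (f i x) \<le> c * cmod (g x)" and h: "\<And>x. (\<lambda>i. f i x) \<longlonglongrightarrow> h x"
  for f :: "nat \<Rightarrow> 'a \<times> 'b \<Rightarrow> complex" and g h c
  proof -
    have m: "f i \<in> borel_measurable borel" for i
      using N_sq[OF f] by auto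
    note * = tendsto_abs_l2_dominated[OF g m bound h]
    have "(\<lambda>i. D (abs_l2 (f i))) \<longlonglongrightarrow> D (abs_l2 h)"
      by (rule tendsto[OF *(2)])
    moreover have "(\<lambda>i. D (abs_l2 (f i))) = (\<lambda>i. 0)"
      using f by (simp add: N_def)
    ultimately have "D (abs_l2 h) = 0"
      using LIMSEQ_unique tendsto_const by metis
    with *(1) show "N h"
      by (simp add: N_def)
  qed
  have N_rect: "N (indicator (A \<times> B))"
    if A: "A \<in> sets borel" "emeasure lborel A < \<infinity>" and B: "B \<in> sets borel" "emeasure lborel B < \<infinity>"
    for A :: "'a set" and B :: "'b set"
  proof -
    have eq: "(\<lambda>z. indicator A (fst z) * indicator B (snd z)) = (indicator (A \<times> B) :: _ \<Rightarrow> complex)"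
      by (auto simp: fun_eq_iff indicator_def)
    note sq = square_integrable_indicator[OF A] square_integrable_indicator[OF B]
    from D0[of "abs_l2 (indicator A)" "abs_l2 (indicator B)"] show ?thesis
      using square_integrable_tensor[OF sq] unfolding N_def tensor_abs[OF sq] eq by blast
  qed
  \<comment> \<open>These rectangles have finite measure and exhaust the product space.\<close>
  define C where "C n = (cball 0 (real n) :: 'a set) \<times> (cball 0 (real n) :: 'b set)" for n
  have N_C: "N (indicator (C n))" for n
    unfolding C_def by (intro N_rect) (simp_all add: emeasure_lborel_cball_finite[unfolded infinity_ennreal_def])
  \<comment> \<open>Dynkin's lemma for the intersection-stable generator of measurable rectangles.
    Cutting with \<open>C n\<close> keeps all measures finite: complements are taken relative to
    \<open>C n\<close>, whose indicator also dominates the countable unions.\<close>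
  have N_box: "N (indicator (E \<inter> C n))" if E: "E \<in> sets borel" for E n
  proof -
    let ?G = "{A \<times> B | A B. A \<in> sets (borel :: 'a measure) \<and> B \<in> sets (borel :: 'b measure)}"
    have sets: "sets (borel :: ('a \<times> 'b) measure) = sigma_sets UNIV ?G"
      by (subst borel_prod[symmetric]) (simp add: sets_pair_measure)
    have "Int_stable ?G"
      using Int_stable_pair_measure_generator[of "borel :: 'a measure" "borel :: 'b measure"] .
    from this subset_UNIV[of "?G", folded Pow_UNIV] show ?thesis
      using E unfolding sets
    proof (induction rule: sigma_sets_induct_disjoint)
      case (basic A)
      then obtain X Y where XY: "A = X \<times> Y" "X \<in> sets borel" "Y \<in> sets borel"
        by auto
      have *: "emeasure lborel (X \<inter> cball 0 r) < \<infinity>" for X :: "'e::euclidean_space set" and r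
        by (rule le_less_trans[OF emeasure_mono[of _ "cball 0 r"] emeasure_lborel_cball_finite]) auto
      have "A \<inter> C n = (X \<inter> cball 0 n) \<times> (Y \<inter> cball 0 n)"
        by (auto simp: XY C_def)
      then show ?case
        using XY(2,3) by (simp only:) (intro N_rect * sets.Int; simp)
    next
      case empty
      show ?case
        using N_zero by (simp add: indicator_def[abs_def])
    next
      case (compl A)
      have "(\<lambda>x. indicator (C n) x - indicator (A \<inter> C n) x)
          = (indicator ((UNIV - A) \<inter> C n) :: _ \<Rightarrow> complex)"
        by (auto simp: fun_eq_iff indicator_def)
      with N_diff[OF N_C[of n] compl(2)] show ?case
        by simp
    next
      case (union A)
      show ?case
      proof (rule N_lim[of "indicator (C n)"
            "\<lambda>k x. \<Sum>i<k. indicator (A i \<inter> C n) x" 1])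
        \<comment> \<open>Disjointness turns the partial sums into indicators of finite unions,
          hence bounded by the indicator of \<open>C n\<close>.\<close>
        have eq: "(\<Sum>i<k. indicator (A i \<inter> C n) x)
            = (indicator ((\<Union>i<k. A i) \<inter> C n) x :: complex)" for k x
        proof -
          have d: "disjoint_family_on (\<lambda>i. A i \<inter> C n) {..<k}"
            using union(1) by (auto simp: disjoint_family_on_def)
          have "indicator (\<Union>i<k. A i \<inter> C n) x = (\<Sum>i<k. indicator (A i \<inter> C n) x :: complex)"
            by (rule indicator_UN_disjoint[OF _ d]) simp
          then show ?thesis
            by simp
        qed
        show "square_integrable (indicator (C n))"
          by (rule N_sq[OF N_C])
        show "N (\<lambda>x. \<Sum>i<k. indicator (A i \<inter> C n) x)" for k
          by (rule N_sum) (rule union(3))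
        show "cmod (\<Sum>i<k. indicator (A i \<inter> C n) x) \<le> 1 * cmod (indicator (C n) x)" for k x
          unfolding eq by (auto simp: indicator_def)
        show "(\<lambda>k. \<Sum>i<k. indicator (A i \<inter> C n) x) \<longlonglongrightarrow> (indicator (\<Union> (range A) \<inter> C n) x :: complex)"
          for x
        proof (cases "x \<in> \<Union> (range A) \<inter> C n")
          case True
          then obtain j where j: "x \<in> A j" "x \<in> C n"
            by auto
          \<comment> \<open>The partial sums range over indices below \<open>k\<close>, so the set
            containing the point, \<open>A j\<close>, is included from \<open>Suc j\<close>
            on.\<close>
          then have "\<forall>\<^sub>F k in sequentially. (\<Sum>i<k. indicator (A i \<inter> C n) x) = (1 :: complex)"
            unfolding eq by (intro eventually_sequentiallyI[of "Suc j"]) (auto simp: indicator_def)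
          with True show ?thesis
            by (simp add: tendsto_eventually)
        next
          case False
          then show ?thesis
            unfolding eq by (auto simp: indicator_def)
        qed
      qed
    qed
  qed
  have N_ind: "N (indicator E)" if E: "E \<in> sets borel" "emeasure lborel E < \<infinity>" for E
  proof (rule N_lim[of "indicator E" "\<lambda>n. indicator (E \<inter> C n)" 1])
    show "square_integrable (indicator E)"
      by (rule square_integrable_indicator[OF E])
    show "N (indicator (E \<inter> C n))" for n
      by (rule N_box[OF E(1)])
    show "cmod (indicator (E \<inter> C n) x) \<le> 1 * cmod (indicator E x)" for n x
      by (auto simp: indicator_def)
    show "(\<lambda>n. indicator (E \<inter> C n) x) \<longlonglongrightarrow> (indicator E x :: complex)" for x
    proof -
      \<comment> \<open>From index \<open>m\<close> on both components of the point lie in the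
        balls, so the sequence is eventually constant.\<close>
      obtain m where m: "max (norm (fst x)) (norm (snd x)) \<le> real m"
        using real_arch_simple by blast
      have "\<forall>\<^sub>F n in sequentially. indicator (E \<inter> C n) x = (indicator E x :: complex)"
        using m
        by (intro eventually_sequentiallyI[of m]) (auto simp: indicator_def C_def mem_Times_iff)
      then show ?thesis
        by (rule tendsto_eventually)
    qed
  qed
  have N_simple: "N s" if s: "simple_function borel s" "square_integrable s" for s
  proof -
    have [measurable]: "s \<in> borel_measurable borel"
      using s(2) by auto
    have "N (\<lambda>x. y * indicator (s -` {y}) x)" for y
    \<comment> \<open>A nonzero level has finite measure by Chebyshev's inequality. The zero level
      may have infinite measure, but its term is the zero function.\<close>
    proof (cases "y = 0")
      case False
      have [measurable]: "s -` {y} \<in> sets borel"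
        using measurable_sets[of s borel borel "{y}"] by simp
      have "ennreal ((cmod y)\<^sup>2) * emeasure lborel (s -` {y})
          = (\<integral>\<^sup>+x. ennreal ((cmod y)\<^sup>2) * indicator (s -` {y}) x \<partial>lborel)"
        by (simp add: nn_integral_cmult)
      also have "\<dots> \<le> (\<integral>\<^sup>+x. ennreal ((cmod (s x))\<^sup>2) \<partial>lborel)"
        by (intro nn_integral_mono) (auto simp: indicator_def)
      also have "\<dots> < \<infinity>"
        using s(2) by (simp add: square_integrable_nn_integral)
      finally have "emeasure lborel (s -` {y}) < \<infinity>"
        using False by (auto simp: ennreal_mult_less_top ennreal_eq_0_iff)
      then show ?thesis
        by (intro N_cmult N_ind) auto
    qed (simp add: N_zero)
    then have "N (\<lambda>x. \<Sum>y\<in>range s. y * indicator (s -` {y}) x)"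
      by (intro N_sum)
    moreover have "(\<Sum>y\<in>range s. y * indicator (s -` {y}) x) = s x" for x
    proof -
      have "(\<Sum>y\<in>range s. y * indicator (s -` {y}) x) = (\<Sum>y\<in>range s. if y = s x then y else 0)"
        by (intro sum.cong) (auto simp: indicator_def)
      then show ?thesis
        using simple_functionD(1)[OF s(1)] by simp
    qed
    ultimately show ?thesis
      by simp
  qed
  obtain f where f: "square_integrable f" "F = abs_l2 f"
    by (rule abs_l2_cases)
  have "f \<in> borel_measurable borel"
    using f by auto
  \<comment> \<open>Simple approximation with base point 0 stays within twice the modulus of
    \<open>f\<close>; this makes each \<open>s i\<close> square integrable and supplies the
    domination for the limit.\<close>
  then obtain s where s: "\<And>i. simple_function borel (s i)" "\<And>x. (\<lambda>i. s i x) \<longlonglongrightarrow> f x"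
    "\<And>i x. dist (s i x) 0 \<le> 2 * dist (f x) 0"
    using borel_measurable_implies_sequence_metric[of f borel 0]
    unfolding space_borel ball_UNIV by metis
  have bound: "cmod (s i x) \<le> 2 * cmod (f x)" for i x
    using s(3)[of i x] by simp
  have "N f"
  proof (rule N_lim[OF f(1) _ bound s(2)])
    show "N (s i)" for i
      using s(1)[of i]
      by (intro N_simple square_integrable_bound[OF f(1) _ bound])
        (auto intro: borel_measurable_simple_function)
  qed
  then show ?thesis
    by (simp add: N_def f)
qed


section \<open>Leg numbering\<close>

lemma bounded_clinear_comp:
  "bounded_clinear S \<Longrightarrow> bounded_clinear T \<Longrightarrow> bounded_clinear (\<lambda>F. S (T F))"
  by (auto simp: bounded_clinear_def bounded_linear_compose)

lemma scaleC_diff_right: "c *\<^sub>C (F - G) = c *\<^sub>C F - c *\<^sub>C (G :: 'a::euclidean_space l2)"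
proof -
  obtain f where f: "square_integrable f" "F = abs_l2 f" by (rule abs_l2_cases)
  obtain g where g: "square_integrable g" "G = abs_l2 g" by (rule abs_l2_cases)
  show ?thesis
    by (simp add: f g abs_l2_diff abs_l2_scaleC square_integrable_diff square_integrable_cmult
        right_diff_distrib)
qed

lemma bounded_clinear_diff:
  "bounded_clinear S \<Longrightarrow> bounded_clinear T \<Longrightarrow> bounded_clinear (\<lambda>F. S F - T F)"
  by (auto simp: bounded_clinear_def bounded_linear_sub scaleC_diff_right)

lemma bounded_clinear_eq_if_tensor:
  assumes "bounded_clinear S" "bounded_clinear T" "\<And>\<xi> \<zeta>. S (tensor \<xi> \<zeta>) = T (tensor \<xi> \<zeta>)"
  shows "S F = T F"
  using bounded_clinear_eq_zero_if_tensor[OF bounded_clinear_diff[OF assms(1,2)]] assms(3) by simp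

text \<open>On functions of a pair this operator is \<open>wcomp u T\<close> tensored with the
  identity.\<close>

lemma wcomp_tensor:
  assumes uT: "weighted_measure_preserving u T"
  shows "wcomp (\<lambda>z. u (fst z)) (\<lambda>z. (T (fst z), snd z)) (tensor \<xi> \<zeta>) = tensor (wcomp u T \<xi>) \<zeta>"
proof -
  obtain f where f: "square_integrable f" "\<xi> = abs_l2 f" by (rule abs_l2_cases)
  obtain g where g: "square_integrable g" "\<zeta> = abs_l2 g" by (rule abs_l2_cases)
  show ?thesis
    by (simp add: f g tensor_abs wcomp_abs[OF uT] wcomp_abs[OF weighted_measure_preserving_fst[OF uT]]
        square_integrable_tensor square_integrable_wcomp[OF uT] mult.assoc)
qed

text \<open>Here \<open>\<pi>\<close> groups the active pair of coordinates in front and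
  \<open>\<rho>\<close> is its inverse. The leg operator is the operator on the pair, tensored with
  the identity and conjugated by this permutation.\<close>

lemma
  fixes \<pi> :: "'a::euclidean_space \<times> 'a \<times> 'a \<Rightarrow> ('a \<times> 'a) \<times> 'a"
  assumes t: "\<And>\<xi> \<zeta>. t \<xi> \<zeta> = wcomp (\<lambda>_. 1) \<pi> (tensor \<xi> \<zeta>)"
    and \<pi>: "weighted_measure_preserving (\<lambda>_. 1) \<pi>"
    and \<rho>: "\<rho> \<in> borel_measurable borel" "\<And>z. \<rho> (\<pi> z) = z" "\<And>w. \<pi> (\<rho> w) = w"
    and uT: "weighted_measure_preserving u T"
  shows weighted_measure_preserving_leg:
      "weighted_measure_preserving (\<lambda>z. u (fst (\<pi> z))) (\<lambda>z. \<rho> (T (fst (\<pi> z)), snd (\<pi> z)))" (is ?wmp)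
    and leg_wcomp:
      "leg t (wcomp u T) = wcomp (\<lambda>z. u (fst (\<pi> z))) (\<lambda>z. \<rho> (T (fst (\<pi> z)), snd (\<pi> z)))"
      (is "_ = ?V")
proof -
  note \<rho>' = weighted_measure_preserving_inverse[OF \<pi> \<rho>(1,2)]
  note uT' = weighted_measure_preserving_fst[OF uT, where 'c = 'a]
  show V: ?wmp
    using weighted_measure_preserving_comp[OF weighted_measure_preserving_comp[OF \<pi> uT'] \<rho>'] by simp
  \<comment> \<open>Since \<pi> \<circ> \<rho> is the identity, the inner permutations
    cancel.\<close>
  have V_t: "?V (t \<xi> \<zeta>) = t (wcomp u T \<xi>) \<zeta>" for \<xi> \<zeta>
  proof -
    have "?V (t \<xi> \<zeta>) = wcomp (\<lambda>_. 1) \<pi> (wcomp (\<lambda>z. u (fst z)) (\<lambda>z. (T (fst z), snd z)) (tensor \<xi> \<zeta>))"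
      unfolding t wcomp_wcomp[OF V \<pi>] wcomp_wcomp[OF \<pi> uT'] by (simp add: \<rho>)
    then show ?thesis
      by (simp add: wcomp_tensor[OF uT] t)
  qed
  show "leg t (wcomp u T) = ?V"
    unfolding leg_def
  proof (rule the_equality)
    show "bounded_clinear ?V \<and> (\<forall>\<xi> \<zeta>. ?V (t \<xi> \<zeta>) = t (wcomp u T \<xi>) \<zeta>)"
      using bounded_clinear_wcomp[OF V] V_t by blast
    fix W
    assume W: "bounded_clinear W \<and> (\<forall>\<xi> \<zeta>. W (t \<xi> \<zeta>) = t (wcomp u T \<xi>) \<zeta>)"
    \<comment> \<open>Precomposing with the permutation operator moves the comparison to (pair,
      remaining factor), where elementary tensors determine a bounded operator. Surjectivity of the
      permutation operator then removes it again.\<close>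
    have eq: "W (wcomp (\<lambda>_. 1) \<pi> F) = ?V (wcomp (\<lambda>_. 1) \<pi> F)" for F
    proof (rule bounded_clinear_eq_if_tensor[where S = "\<lambda>F. W (wcomp (\<lambda>_. 1) \<pi> F)"
          and T = "\<lambda>F. ?V (wcomp (\<lambda>_. 1) \<pi> F)"])
      show "bounded_clinear (\<lambda>F. W (wcomp (\<lambda>_. 1) \<pi> F))"
        "bounded_clinear (\<lambda>F. ?V (wcomp (\<lambda>_. 1) \<pi> F))"
        using W by (blast intro: bounded_clinear_comp bounded_clinear_wcomp V \<pi>)+
      show "W (wcomp (\<lambda>_. 1) \<pi> (tensor \<xi> \<zeta>)) = ?V (wcomp (\<lambda>_. 1) \<pi> (tensor \<xi> \<zeta>))" for \<xi> \<zeta>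
        using W V_t unfolding t by simp
    qed
    show "W = ?V"
    proof
      fix G
      obtain F where "G = wcomp (\<lambda>_. 1) \<pi> F"
        using surj_wcomp[OF \<pi> \<rho>(1,2)] by (metis surjD)
      with eq show "W G = ?V G"
        by simp
    qed
  qed
qed

lemma weighted_measure_preserving_permutations:
  "weighted_measure_preserving (\<lambda>_. 1)
    (\<lambda>z :: 'a::euclidean_space \<times> 'b::euclidean_space \<times> 'c::euclidean_space. ((fst z, fst (snd z)), snd (snd z)))"
  "weighted_measure_preserving (\<lambda>_. 1)
    (\<lambda>z :: 'a \<times> 'b \<times> 'c. ((fst z, snd (snd z)), fst (snd z)))"
  "weighted_measure_preserving (\<lambda>_. 1)
    (\<lambda>z :: 'a \<times> 'b \<times> 'c. ((fst (snd z), snd (snd z)), fst z))"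
  unfolding weighted_measure_preserving_def
  by (auto simp: nn_integral_permute_12_3 nn_integral_permute_13_2 nn_integral_permute_23_1
      simp del: prod.collapse)

text \<open>This brings the three embeddings into the common form required by
  \<open>leg_wcomp\<close>, each with its own permutation.\<close>

lemma tensor_legs:
  fixes \<xi> :: "('a::euclidean_space \<times> 'a) l2"
  shows "tensor12 \<xi> \<zeta> = wcomp (\<lambda>_. 1) (\<lambda>z. ((fst z, fst (snd z)), snd (snd z))) (tensor \<xi> \<zeta>)"
    and "tensor13 \<xi> \<zeta> = wcomp (\<lambda>_. 1) (\<lambda>z. ((fst z, snd (snd z)), fst (snd z))) (tensor \<xi> \<zeta>)"
    and "tensor23 \<xi> \<zeta> = wcomp (\<lambda>_. 1) (\<lambda>z. ((fst (snd z), snd (snd z)), fst z)) (tensor \<xi> \<zeta>)"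
proof -
  obtain f where f: "square_integrable f" "\<xi> = abs_l2 f" by (rule abs_l2_cases)
  obtain g where g: "square_integrable g" "\<zeta> = abs_l2 g" by (rule abs_l2_cases)
  note * = f g l2_rel_refl_iff tensor_abs square_integrable_tensor case_prod_beta'
    wcomp_abs weighted_measure_preserving_permutations
  show "tensor12 \<xi> \<zeta> = wcomp (\<lambda>_. 1) (\<lambda>z. ((fst z, fst (snd z)), snd (snd z))) (tensor \<xi> \<zeta>)"
    by (simp add: * tensor12.abs_eq del: prod.collapse)
  show "tensor13 \<xi> \<zeta> = wcomp (\<lambda>_. 1) (\<lambda>z. ((fst z, snd (snd z)), fst (snd z))) (tensor \<xi> \<zeta>)"
    by (simp add: * tensor13.abs_eq del: prod.collapse)
  show "tensor23 \<xi> \<zeta> = wcomp (\<lambda>_. 1) (\<lambda>z. ((fst (snd z), snd (snd z)), fst z)) (tensor \<xi> \<zeta>)"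
    by (simp add: * tensor23.abs_eq del: prod.collapse)
qed

lemma
  fixes u :: "'a::euclidean_space \<times> 'a \<Rightarrow> complex"
  assumes uT: "weighted_measure_preserving u T"
  shows leg12_wcomp: "leg tensor12 (wcomp u T)
      = wcomp (\<lambda>(p, q, s :: 'a). u (p, q)) (\<lambda>(p, q, s). case T (p, q) of (p', q') \<Rightarrow> (p', q', s))"
    and leg13_wcomp: "leg tensor13 (wcomp u T)
      = wcomp (\<lambda>(p, q :: 'a, s). u (p, s)) (\<lambda>(p, q, s). case T (p, s) of (p', s') \<Rightarrow> (p', q, s'))"
    and leg23_wcomp: "leg tensor23 (wcomp u T)
      = wcomp (\<lambda>(p :: 'a, q, s). u (q, s)) (\<lambda>(p, q, s). case T (q, s) of (q', s') \<Rightarrow> (p, q', s'))"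
    and weighted_measure_preserving_leg12: "weighted_measure_preserving
      (\<lambda>(p, q, s :: 'a). u (p, q)) (\<lambda>(p, q, s). case T (p, q) of (p', q') \<Rightarrow> (p', q', s))"
    and weighted_measure_preserving_leg13: "weighted_measure_preserving
      (\<lambda>(p, q :: 'a, s). u (p, s)) (\<lambda>(p, q, s). case T (p, s) of (p', s') \<Rightarrow> (p', q, s'))"
    and weighted_measure_preserving_leg23: "weighted_measure_preserving
      (\<lambda>(p :: 'a, q, s). u (q, s)) (\<lambda>(p, q, s). case T (q, s) of (q', s') \<Rightarrow> (p, q', s'))"
proof -
  \<comment> \<open>The inverses of the three coordinate permutations, in the role of
    \<open>\<rho>\<close>.\<close>
  have m: "(\<lambda>w :: ('a \<times> 'a) \<times> 'a. (fst (fst w), snd (fst w), snd w)) \<in> borel_measurable borel"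
    "(\<lambda>w :: ('a \<times> 'a) \<times> 'a. (fst (fst w), snd w, snd (fst w))) \<in> borel_measurable borel"
    "(\<lambda>w :: ('a \<times> 'a) \<times> 'a. (snd w, fst (fst w), snd (fst w))) \<in> borel_measurable borel"
    by measurable
  note 12 = tensor_legs(1) weighted_measure_preserving_permutations(1) m(1) _ _ uT
  note 13 = tensor_legs(2) weighted_measure_preserving_permutations(2) m(2) _ _ uT
  note 23 = tensor_legs(3) weighted_measure_preserving_permutations(3) m(3) _ _ uT
  show "leg tensor12 (wcomp u T)
      = wcomp (\<lambda>(p, q, s :: 'a). u (p, q)) (\<lambda>(p, q, s). case T (p, q) of (p', q') \<Rightarrow> (p', q', s))"
    using leg_wcomp[OF 12] by (simp add: case_prod_beta')
  show "leg tensor13 (wcomp u T)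
      = wcomp (\<lambda>(p, q :: 'a, s). u (p, s)) (\<lambda>(p, q, s). case T (p, s) of (p', s') \<Rightarrow> (p', q, s'))"
    using leg_wcomp[OF 13] by (simp add: case_prod_beta')
  show "leg tensor23 (wcomp u T)
      = wcomp (\<lambda>(p :: 'a, q, s). u (q, s)) (\<lambda>(p, q, s). case T (q, s) of (q', s') \<Rightarrow> (p, q', s'))"
    using leg_wcomp[OF 23] by (simp add: case_prod_beta')
  show "weighted_measure_preserving
      (\<lambda>(p, q, s :: 'a). u (p, q)) (\<lambda>(p, q, s). case T (p, q) of (p', q') \<Rightarrow> (p', q', s))"
    using weighted_measure_preserving_leg[OF 12] by (simp add: case_prod_beta')
  show "weighted_measure_preserving
      (\<lambda>(p, q :: 'a, s). u (p, s)) (\<lambda>(p, q, s). case T (p, s) of (p', s') \<Rightarrow> (p', q, s'))"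
    using weighted_measure_preserving_leg[OF 13] by (simp add: case_prod_beta')
  show "weighted_measure_preserving
      (\<lambda>(p :: 'a, q, s). u (q, s)) (\<lambda>(p, q, s). case T (q, s) of (q', s') \<Rightarrow> (p, q', s'))"
    using weighted_measure_preserving_leg[OF 23] by (simp add: case_prod_beta')
qed


section \<open>The operator\<close>

definition U_weight :: "real \<Rightarrow> 'n::finite coords \<times> 'n coords \<Rightarrow> complex" where
  "U_weight lam = (\<lambda>((x, y, r), (x', y', r')).
     complex_of_real (exp (- lam * r') ^ CARD('n))
     * ebar (eta lam r' * inner (exp (- lam * r') *\<^sub>R x) (y' - exp (- lam * r') *\<^sub>R y)))"

definition U_map :: "real \<Rightarrow> 'n::finite coords \<times> 'n coords \<Rightarrow> 'n coords \<times> 'n coords" where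
  "U_map lam = (\<lambda>((x, y, r), (x', y', r')).
     ((exp (- lam * r') *\<^sub>R x, exp (- lam * r') *\<^sub>R y, r + r'),
      (x' - exp (- lam * r') *\<^sub>R x, y' - exp (- lam * r') *\<^sub>R y, r')))"

text \<open>\<open>U_map\<close> fixes r', so the scale factor can be read off from the image; the
  shift is undone by adding the already scaled x and y.\<close>

definition U_map_inv :: "real \<Rightarrow> 'n::finite coords \<times> 'n coords \<Rightarrow> 'n coords \<times> 'n coords" where
  "U_map_inv lam = (\<lambda>((x, y, r), (x', y', r')).
     ((exp (lam * r') *\<^sub>R x, exp (lam * r') *\<^sub>R y, r - r'), (x' + x, y' + y, r')))"

lemma ebar_add: "ebar (s + t) = ebar s * ebar t"
  by (simp add: ebar_def exp_add[symmetric] algebra_simps)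

lemma cmod_ebar [simp]: "cmod (ebar t) = 1"
  by (simp add: ebar_def)

lemma U_map_inv_U_map: "U_map_inv lam (U_map lam z) = z"
  by (auto simp: U_map_inv_def U_map_def exp_minus split: prod.split)

lemma borel_measurable_U_map_inv: "U_map_inv lam \<in> borel_measurable borel"
  unfolding U_map_inv_def case_prod_beta' by measurable

text \<open>The phase has modulus 1, so |u|^2 is exp(- lam r')^(2n), the Jacobian of dilating both x
  and y; the shifts contribute nothing.\<close>

lemma weighted_measure_preserving_U:
  "weighted_measure_preserving (U_weight lam) (U_map lam :: 'n::finite coords \<times> 'n coords \<Rightarrow> _)"
  unfolding weighted_measure_preserving_def
proof (intro conjI allI ballI)
  show "(U_map lam :: 'n coords \<times> 'n coords \<Rightarrow> _) \<in> borel_measurable borel"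
    unfolding U_map_def case_prod_beta' by measurable
  show "(U_weight lam :: 'n coords \<times> 'n coords \<Rightarrow> _) \<in> borel_measurable borel"
    unfolding U_weight_def ebar_def eta_def case_prod_beta' by measurable
  show "U_weight lam z \<noteq> 0" for z :: "'n coords \<times> 'n coords"
    by (auto simp: U_weight_def ebar_def split: prod.split)
  fix h :: "'n coords \<times> 'n coords \<Rightarrow> ennreal"
  assume "h \<in> borel_measurable borel"
  from nn_integral_U[OF this, of lam]
  show "(\<integral>\<^sup>+z. ennreal ((cmod (U_weight lam z))\<^sup>2) * h (U_map lam z) \<partial>lborel) = (\<integral>\<^sup>+w. h w \<partial>lborel)"
    by (simp add: U_weight_def U_map_def Let_def case_prod_beta norm_mult norm_power)
qed

lemma U_op_eq_wcomp: "U_op lam = wcomp (U_weight lam) (U_map lam)"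
proof
  fix F :: "('n::finite coords \<times> 'n coords) l2"
  obtain f where f: "square_integrable f" "F = abs_l2 f" by (rule abs_l2_cases)
  have "U_fun lam f = (\<lambda>z. U_weight lam z * f (U_map lam z))"
    by (auto simp: U_fun_def U_weight_def U_map_def)
  then show "U_op lam F = wcomp (U_weight lam) (U_map lam) F"
    by (simp add: f U_op.abs_eq l2_rel_refl_iff wcomp_abs[OF weighted_measure_preserving_U])
qed

text \<open>The cocycle identity for \<open>eta\<close>, multiplied by exp(- 2 lam s) so that it
  matches the factor c^2 arising in the phases.\<close>

lemma eta_add:
  assumes "lam \<noteq> 0"
  shows "eta lam (r + s) * (exp (- lam * s))\<^sup>2 = eta lam r + eta lam s * (exp (- lam * s))\<^sup>2"
proof -
  have "exp (2 * lam * (r + s)) * (exp (- lam * s))\<^sup>2 = exp (2 * lam * r)"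
    "exp (2 * lam * s) * (exp (- lam * s))\<^sup>2 = 1"
    by (simp_all add: power2_eq_square exp_add[symmetric] algebra_simps)
  then show ?thesis
    using assms by (simp add: eta_def divide_simps) (simp add: algebra_simps)
qed

text \<open>On the left stand the phases of the factors 12, 13, 23 along the successive images of a
  point, on the right those of 23, 12. The b-terms cancel in the second slot of the third inner
  product, leaving y'' - c y'.\<close>

lemma U_phase_pentagon:
  fixes x y x' y' y'' :: "real ^ 'n::finite" and r' r'' :: real
  assumes "lam \<noteq> 0"
  defines "b \<equiv> exp (- lam * r')" and "c \<equiv> exp (- lam * r'')"
  shows "eta lam r' * inner (b *\<^sub>R x) (y' - b *\<^sub>R y)
      + eta lam r'' * inner (c *\<^sub>R b *\<^sub>R x) (y'' - c *\<^sub>R b *\<^sub>R y)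
      + eta lam r'' * inner (c *\<^sub>R (x' - b *\<^sub>R x)) (y'' - c *\<^sub>R b *\<^sub>R y - c *\<^sub>R (y' - b *\<^sub>R y))
    = eta lam r'' * inner (c *\<^sub>R x') (y'' - c *\<^sub>R y')
      + eta lam (r' + r'') * inner ((b * c) *\<^sub>R x) (c *\<^sub>R y' - (b * c) *\<^sub>R y)" (is "?L = ?R")
proof -
  \<comment> \<open>Beyond the term with x' that both sides share, each side is a multiple of
    \<open>B\<close>; the cocycle identity equates the coefficients.\<close>
  define B where "B = inner (b *\<^sub>R x) (y' - b *\<^sub>R y)"
  have "?L = eta lam r'' * inner (c *\<^sub>R x') (y'' - c *\<^sub>R y') + (eta lam r' + eta lam r'' * c\<^sup>2) * B"
    by (simp add: B_def inner_simps algebra_simps power2_eq_square)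
  also have "eta lam r' + eta lam r'' * c\<^sup>2 = eta lam (r' + r'') * c\<^sup>2"
    unfolding c_def by (rule eta_add[OF assms(1), symmetric])
  also have "eta lam r'' * inner (c *\<^sub>R x') (y'' - c *\<^sub>R y') + eta lam (r' + r'') * c\<^sup>2 * B = ?R"
    by (simp add: B_def inner_simps algebra_simps power2_eq_square)
  finally show ?thesis .
qed

theorem proposition3p1:
  fixes lam :: real
    and U :: "('n::finite coords \<times> 'n coords) l2 \<Rightarrow> ('n coords \<times> 'n coords) l2"
  assumes "lam \<noteq> 0"
    and "U = U_op lam"
  shows "unitary U \<and> pentagon_equation U"
proof
  have U: "U = wcomp (U_weight lam) (U_map lam)"
    using assms(2) by (simp add: U_op_eq_wcomp)
  note uT = weighted_measure_preserving_U[of lam, where 'n = 'n]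
  show "unitary U"
    unfolding U unitary_def
    using bounded_clinear_wcomp[OF uT] cinner_wcomp[OF uT]
      surj_wcomp[OF uT borel_measurable_U_map_inv U_map_inv_U_map] by blast
  note wmp = weighted_measure_preserving_leg12[OF uT] weighted_measure_preserving_leg13[OF uT]
    weighted_measure_preserving_leg23[OF uT]
  note comp = wcomp_wcomp[OF wmp(2,3)]
    wcomp_wcomp[OF wmp(1) weighted_measure_preserving_comp[OF wmp(2,3)]] wcomp_wcomp[OF wmp(3,1)]
  \<comment> \<open>On the right the factor 12 dilates by the combined parameter r' + r''; splitting
    the exponential matches it with two successive dilations on the left.\<close>
  have e: "exp (- (lam * (r + s))) = exp (- (lam * r)) * exp (- (lam * s))" for r s
    by (simp add: exp_add[symmetric] algebra_simps)
  show "pentagon_equation U"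
    unfolding pentagon_equation_def U leg12_wcomp[OF uT] leg13_wcomp[OF uT] leg23_wcomp[OF uT]
  \<comment> \<open>Each side is now a single weighted composition operator; equality of the weights
    and of the maps remains.\<close>
  proof (rule ext, unfold o_apply comp, rule arg_cong2[where f = "\<lambda>u T. wcomp u T _"], goal_cases)
    case (1 F)
    show ?case
    proof (rule ext, clarify, goal_cases)
      case (1 x y r x' y' r' x'' y'' r'')
      \<comment> \<open>The amplitudes agree, being b^n c^n c^n and c^n (b c)^n. The phases agree
        because \<open>ebar\<close> turns the additive phase identity into a product.\<close>
      show ?case
        using arg_cong[where f = ebar, OF U_phase_pentagon[OF assms(1), of r' x y' y r'' y'' x']]
        by (simp add: U_weight_def U_map_def e ebar_add power_mult_distrib mult.assoc)
    qed
  next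
    case (2 F)
    show ?case
    proof (rule ext, clarify, goal_cases)
      case (1 x y r x' y' r' x'' y'' r'')
      show ?case
        \<comment> \<open>In the third leg the contributions c b x and c b y cancel, so both routes
          end at x'' - c x' and y'' - c y'.\<close>
        by (simp add: U_map_def e scaleR_diff_right mult.commute add.assoc)
    qed
  qed
qed

end
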